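(* Let $0<t_0<T$. For $i\in\{1,2\}$ let $p_i$ be the law on $\mathbb{R}^D$ of $x=A_iz_i+\varepsilon_i$, where $A_i\in\mathbb{R}^{D\times d_i}$ satisfies $A_i^\top A_i=I_{d_i}$, $z_i\sim p_{i,z}$ is a random vector in $\mathbb{R}^{d_i}$, and $\varepsilon_i\sim\mathcal{N}(0,\sigma_i^2I_D)$ is independent of $z_i$, with $\sigma_i>0$. Assume, for $i=1,2$: (i) the map $f_i^*(z,t):=\widetilde h_i(t)\nabla\log p_{i,t}^{\rm LD}(z)+z$ is $\beta_i$-Lipschitz in $z\in\mathbb{R}^{d_i}$, uniformly over $t\in[0,T]$; (ii) the density $p_{i,z}>0$ is twice continuously differentiable, and there are constants $B_i,C_{1,i},C_{2,i}>0$ with $p_{i,z}(z)\le(2\pi)^{-d_i/2}C_{1,i}\exp\{-C_{2,i}\|z\|_2^2/2\}$ for all $\|z\|_2\ge B_i$; (iii) $\sup_{t\in[t_0,T]}\|g_i(0,t)\|_2<\infty$, and $g_i$ is differentiable in $t$ with $\sup_{t\in[t_0,T],\,\|y\|_2\le R}\|\partial_tg_i(y,t)\|_2<\infty$ for every $R>0$, where $g_i(y,t):=h(t)\nabla\log p_{i,t}^{\rm LD}(y)+y$. Let $\omega_1,\omega_2>0$ with $\omega_1+\omega_2=1$, let $p_{\rm mix}=\omega_1p_1+\omega_2p_2$, and for $k\in\{\max(d_1,d_2),\dots,D\}$ let $W_k\in\mathbb{R}^{D\times k}$ have orthonormal columns spanning a top-$k$ eigenspace of $M_{\rm mix}=\sum_{i=1}^2\omega_i\bar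 c_iA_iA_i^\top$. Suppose that $$\operatorname{span}(A_1)+\operatorname{span}(A_2)\subseteq\operatorname{span}(W_k).$$ Then, for any $\eta>0$, $$\mathcal{B}_{\rm mix}(W_k)\le(1+\eta)\Bigg[\sum_{i=1}^2\omega_i\bar n_i(D-k)+2\sum_{i=1}^2\omega_i\bar n_i(k-d_i)+2\mathfrak{P}(W_k)\Bigg]+\Big(1+\frac1\eta\Big)\inf_{f_\theta\in\mathcal{F}_{\rm ReLU}^{(k)}}\mathcal{A}_{\rm mix}(f_\theta;W_k),$$ where $\bar n_i:=\frac{1}{T-t_0}\int_{t_0}^T\frac{\alpha^4(t)\sigma_i^4}{h^2(t)\widetilde h_i(t)}\,\mathrm{d}t$. In particular, if $V_1=A_1$, then $$\Gamma(V_1)=\omega_2\bar c_2\|P_{A_1}^\perp A_2\|_F^2,\qquad\Gamma(W_k)=0.$$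
   Context: Forward process: $\alpha(t)=e^{-t/2}$, $h(t)=1-e^{-t}$, $X_t\mid X_0\sim\mathcal{N}(\alpha(t)X_0,h(t)I_D)$; $p_{i,t}$ and $p_{{\rm mix},t}=\omega_1p_{1,t}+\omega_2p_{2,t}$ are the densities of $X_t$ when $X_0\sim p_i$ and $X_0\sim p_{\rm mix}$. $\widetilde h_i(t)=\alpha^2(t)\sigma_i^2+h(t)$; $p_{i,t}^{\rm LD}(y)=\int_{\mathbb{R}^{d_i}}\phi_{i,t}(y\mid z)p_{i,z}(z)\,\mathrm{d}z$ with $\phi_{i,t}(\cdot\mid z)$ the density of $\mathcal{N}(\alpha(t)z,\widetilde h_i(t)I_{d_i})$. $\operatorname{span}(A)$ is the column space of $A$. For a matrix $U\in\mathbb{R}^{D\times m}$ with orthonormal columns, $P_U^\perp=I_D-UU^\top$. Constants: $\lambda_{g,i}^{\max}(t)=\lambda_{\max}\big(\mathbb{E}_{X_t\sim p_{i,t}}[g_i(A_i^\top X_t,t)g_i(A_i^\top X_t,t)^\top]\big)$, $\bar c_i=\frac{1}{T-t_0}\int_{t_0}^T\frac{\lambda_{g,i}^{\max}(t)}{h^2(t)}\,\mathrm{d}t$, and $\Gamma(U)=\sum_{i=1}^2\omega_i\bar c_i\|P_U^\perp A_i\|_F^2$. ReLU class: $\mathcal{F}_{\rm ReLU}^{(m)}=\mathcal{F}_{\rm ReLU}^{(m)}(L,M,J,K,\kappa,\gamma,\gamma_t)$ is the set of functions $f(z,t)=W_L\sigma(\cdots\sigma(W_1[z^\top,t]^\top+b_1)\cdots)+b_L$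 from $\mathbb{R}^m\times[0,T]$ to $\mathbb{R}^m$ (here $W_\ell,b_\ell$ are network weights), $\sigma$ the entrywise ReLU, with width at most $M$, $\sup_{z,t}\|f(z,t)\|_2\le K$, all entries of weights and biases bounded by $\kappa$ in absolute value, at most $J$ nonzero weights and biases in total, $\|f(z_1,t)-f(z_2,t)\|_2\le\gamma\|z_1-z_2\|_2$ for all $t\in[0,T]$, and $\|f(z,t_1)-f(z,t_2)\|_2\le\gamma_t|t_1-t_2|$ for all $z$. Oracle risk: $\mathcal{S}_{\rm mix}(U)=\{\frac{1}{h(t)}Uf_\theta(U^\top x,t)-\frac{1}{h(t)}x:\ f_\theta\in\mathcal{F}_{\rm ReLU}^{(m)}\}$, $\mathcal{L}_{\rm mix}(s)=\frac{1}{T-t_0}\int_{t_0}^T\mathbb{E}_{X_t\sim p_{{\rm mix},t}}\|s(X_t,t)-\nabla\log p_{{\rm mix},t}(X_t)\|_2^2\,\mathrm{d}t$, and $\mathcal{B}_{\rm mix}(U)=\inf_{s\in\mathcal{S}_{\rm mix}(U)}\mathcal{L}_{\rm mix}(s)$. Comparators: $\pi_i(x,t)=\omega_ip_{i,t}(x)/p_{{\rm mix},t}(x)$; $q_{i,U,t}$ is the density of $U^\top X_t$ for $X_t\sim p_{i,t}$; $\pi_i^U(z,t)=\omega_iq_{i,U,t}(z)/(\omega_1q_{1,U,t}(z)+\omega_2q_{2,U,t}(z))$; $H_i(U)=U^\top A_i$; $\psi_{i,U}(z,t)=H_i(U)\,g_i(H_i(U)^\dagger z,t)$ with $\dagger$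 the Moore–Penrose pseudoinverse; $f_{{\rm mix},U}^{\rm comp}(z,t)=\pi_1^U(z,t)\psi_{1,U}(z,t)+\pi_2^U(z,t)\psi_{2,U}(z,t)$. Error terms: $$\mathcal{A}_{\rm mix}(f_\theta;U)=\frac{1}{T-t_0}\int_{t_0}^T\frac{1}{h^2(t)}\mathbb{E}_{X_t\sim p_{{\rm mix},t}}\|f_\theta(U^\top X_t,t)-f_{{\rm mix},U}^{\rm comp}(U^\top X_t,t)\|_2^2\,\mathrm{d}t,$$ $$\mathfrak{P}(U)=\frac{1}{T-t_0}\int_{t_0}^T\frac{1}{h^2(t)}\mathbb{E}_{X_t\sim p_{{\rm mix},t}}\Big[(\pi_1^U(U^\top X_t,t)-\pi_1(X_t,t))^2\|\psi_{1,U}(U^\top X_t,t)-\psi_{2,U}(U^\top X_t,t)\|_2^2\Big]\mathrm{d}t.$$ *)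

theory Defs
  imports "HOL-Probability.Probability"
begin

text \<open>
  Dimensions are types: \<open>'n\<close> indexes the ambient space (\<open>D = CARD('n)\<close>), \<open>'d\<close> a latent space
  (\<open>d\<^sub>i = CARD('d)\<close>), and \<open>'m\<close> (or \<open>'k\<close>) the columns of a projection matrix. An
  \<open>a \<times> b\<close> matrix has type \<open>real^'b^'a\<close>, on which \<open>norm\<close> is the Frobenius norm.
\<close>

definition orthonormal_cols :: "real^'m^'n \<Rightarrow> bool" where
  "orthonormal_cols U \<longleftrightarrow> transpose U ** U = mat 1"

definition perp_proj :: "real^'m^'n \<Rightarrow> real^'n^'n" where
  "perp_proj U = mat 1 - U ** transpose U"

definition eigenvalue :: "real^'d^'d \<Rightarrow> real \<Rightarrow> bool" where
  "eigenvalue S l \<longleftrightarrow> (\<exists>v. v \<noteq> 0 \<and> S *v v = l *\<^sub>R v)"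

definition lambda_max :: "real^'d^'d \<Rightarrow> real" where
  "lambda_max S = (GREATEST l. eigenvalue S l)"

text \<open>
  \<open>V\<close> is the span of the first \<open>k\<close> vectors of some orthonormal eigenbasis \<open>v 0, v 1, \<dots>\<close> of \<open>S\<close>
  listed by nonincreasing eigenvalue; with ties at position \<open>k\<close> there are several such \<open>V\<close>.
\<close>

definition top_eigenspace :: "nat \<Rightarrow> real^'n^'n \<Rightarrow> (real^'n) set \<Rightarrow> bool" where
  "top_eigenspace k S V \<longleftrightarrow>
    (\<exists>(v :: nat \<Rightarrow> real^'n) (l :: nat \<Rightarrow> real).
       (\<forall>i<CARD('n). \<forall>j<CARD('n). v i \<bullet> v j = (if i = j then 1 else 0)) \<and>
       (\<forall>i<CARD('n). S *v v i = l i *\<^sub>R v i) \<and>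
       (\<forall>i j. i \<le> j \<longrightarrow> j < CARD('n) \<longrightarrow> l j \<le> l i) \<and>
       V = span (v ` {..<k}))"

text \<open>The Moore--Penrose inverse, as the matrix satisfying the four Penrose equations.\<close>

definition pinv :: "real^'d^'m \<Rightarrow> real^'m^'d" where
  "pinv H = (THE X. H ** X ** H = H \<and> X ** H ** X = X \<and>
      transpose (H ** X) = H ** X \<and> transpose (X ** H) = X ** H)"

definition grad :: "('a::real_inner \<Rightarrow> real) \<Rightarrow> 'a \<Rightarrow> 'a" where
  "grad f x = (THE D. GDERIV f x :> D)"

definition twice_continuously_differentiable :: "(real^'d \<Rightarrow> real) \<Rightarrow> bool" where
  "twice_continuously_differentiable f \<longleftrightarrow>
    (\<exists>(G :: real^'d \<Rightarrow> real^'d) (H :: real^'d \<Rightarrow> real^'d^'d).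
       (\<forall>x. GDERIV f x :> G x) \<and>
       (\<forall>x. (G has_derivative (\<lambda>v. H x *v v)) (at x)) \<and>
       continuous_on UNIV H)"

text \<open>The density at \<open>x\<close> of the Gaussian with mean \<open>m\<close> and covariance \<open>v\<close> times the identity.\<close>

definition gauss :: "'a::euclidean_space \<Rightarrow> real \<Rightarrow> 'a \<Rightarrow> real" where
  "gauss m v x =
     (2 * pi * v) powr (- real DIM('a) / 2) * exp (- (norm (x - m))\<^sup>2 / (2 * v))"

definition time_avg :: "real \<Rightarrow> real \<Rightarrow> (real \<Rightarrow> real) \<Rightarrow> real" where
  "time_avg t0 T f = 1 / (T - t0) * (LINT t:{t0..T}|lborel. f t)"

definition nn_time_avg :: "real \<Rightarrow> real \<Rightarrow> (real \<Rightarrow> ennreal) \<Rightarrow> ennreal" where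
  "nn_time_avg t0 T f = ennreal (1 / (T - t0)) * (\<integral>\<^sup>+t\<in>{t0..T}. f t \<partial>lborel)"

definition alpha :: "real \<Rightarrow> real" where
  "alpha t = exp (- t / 2)"

definition hvar :: "real \<Rightarrow> real" where
  "hvar t = 1 - exp (- t)"

record ('d::finite, 'n::finite) component =
  loading :: "real^'d^'n"
  noise_sd :: real
  latent_density :: "real^'d \<Rightarrow> real"

definition htilde :: "('d::finite, 'n::finite) component \<Rightarrow> real \<Rightarrow> real" where
  "htilde C t = (alpha t)\<^sup>2 * (noise_sd C)\<^sup>2 + hvar t"

text \<open>The law of \<open>A z + \<epsilon>\<close> with independent \<open>z \<sim> p\<^sub>z\<close> and \<open>\<epsilon> \<sim> N(0, \<sigma>\<^sup>2 I)\<close>.\<close>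

definition data_law :: "('d::finite, 'n::finite) component \<Rightarrow> (real^'n) measure" where
  "data_law C =
     distr (density lborel (\<lambda>z. ennreal (latent_density C z)) \<Otimes>\<^sub>M
            density lborel (\<lambda>e. ennreal (gauss 0 ((noise_sd C)\<^sup>2) e)))
       borel (\<lambda>(z, e). loading C *v z + e)"

text \<open>
  The density of \<open>X\<^sub>t\<close>, obtained by integrating the conditional density of \<open>X\<^sub>t\<close> given \<open>X\<^sub>0\<close>; this
  is the everywhere smooth version, so that its score is defined pointwise (for \<open>t > 0\<close>).
\<close>

definition fwd_density :: "('d::finite, 'n::finite) component \<Rightarrow> real \<Rightarrow> real^'n \<Rightarrow> real" where
  "fwd_density C t x = (\<integral>x0. gauss (alpha t *\<^sub>R x0) (hvar t) x \<partial>data_law C)"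

definition fwd_law :: "('d::finite, 'n::finite) component \<Rightarrow> real \<Rightarrow> (real^'n) measure" where
  "fwd_law C t = density lborel (\<lambda>x. ennreal (fwd_density C t x))"

definition mix_density ::
  "real \<Rightarrow> real \<Rightarrow> ('d1::finite, 'n::finite) component \<Rightarrow> ('d2::finite, 'n) component \<Rightarrow>
   real \<Rightarrow> real^'n \<Rightarrow> real" where
  "mix_density w1 w2 C1 C2 t x = w1 * fwd_density C1 t x + w2 * fwd_density C2 t x"

definition mix_law ::
  "real \<Rightarrow> real \<Rightarrow> ('d1::finite, 'n::finite) component \<Rightarrow> ('d2::finite, 'n) component \<Rightarrow>
   real \<Rightarrow> (real^'n) measure" where
  "mix_law w1 w2 C1 C2 t = density lborel (\<lambda>x. ennreal (mix_density w1 w2 C1 C2 t x))"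

definition ld_density :: "('d::finite, 'n::finite) component \<Rightarrow> real \<Rightarrow> real^'d \<Rightarrow> real" where
  "ld_density C t y =
     (\<integral>z. gauss (alpha t *\<^sub>R z) (htilde C t) y * latent_density C z \<partial>lborel)"

definition ld_score :: "('d::finite, 'n::finite) component \<Rightarrow> real \<Rightarrow> real^'d \<Rightarrow> real^'d" where
  "ld_score C t = grad (\<lambda>y. ln (ld_density C t y))"

definition fstar :: "('d::finite, 'n::finite) component \<Rightarrow> real^'d \<Rightarrow> real \<Rightarrow> real^'d" where
  "fstar C z t = htilde C t *\<^sub>R ld_score C t z + z"

definition gfun :: "('d::finite, 'n::finite) component \<Rightarrow> real^'d \<Rightarrow> real \<Rightarrow> real^'d" where
  "gfun C y t = hvar t *\<^sub>R ld_score C t y + y"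

definition uniformly_lipschitz_fstar ::
  "real \<Rightarrow> real \<Rightarrow> ('d::finite, 'n::finite) component \<Rightarrow> bool" where
  "uniformly_lipschitz_fstar T \<beta> C \<longleftrightarrow>
    (\<forall>t\<in>{0..T}. \<beta>-lipschitz_on UNIV (\<lambda>z. fstar C z t))"

definition regular_latent_density :: "('d::finite, 'n::finite) component \<Rightarrow> bool" where
  "regular_latent_density C \<longleftrightarrow>
    prob_space (density lborel (\<lambda>z. ennreal (latent_density C z))) \<and>
    (\<forall>z. latent_density C z > 0) \<and>
    twice_continuously_differentiable (latent_density C) \<and>
    (\<exists>B>0. \<exists>c1>0. \<exists>c2>0. \<forall>z. norm z \<ge> B \<longrightarrow>
       latent_density C z \<le>
         (2 * pi) powr (- real CARD('d) / 2) * c1 * exp (- c2 * (norm z)\<^sup>2 / 2))"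

definition time_regular_gfun ::
  "real \<Rightarrow> real \<Rightarrow> ('d::finite, 'n::finite) component \<Rightarrow> bool" where
  "time_regular_gfun t0 T C \<longleftrightarrow>
    bdd_above ((\<lambda>t. norm (gfun C 0 t)) ` {t0..T}) \<and>
    (\<forall>y. (\<lambda>t. gfun C y t) differentiable_on {t0..T}) \<and>
    (\<forall>R>0. bdd_above
       ((\<lambda>(t, y). norm (vector_derivative (\<lambda>s. gfun C y s) (at t within {t0..T}))) `
          ({t0..T} \<times> cball 0 R)))"

definition lambda_g_max :: "('d::finite, 'n::finite) component \<Rightarrow> real \<Rightarrow> real" where
  "lambda_g_max C t =
     lambda_max (\<integral>x. (\<chi> i j. gfun C (transpose (loading C) *v x) t $ i *
                           gfun C (transpose (loading C) *v x) t $ j) \<partial>fwd_law C t)"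

definition cbar :: "real \<Rightarrow> real \<Rightarrow> ('d::finite, 'n::finite) component \<Rightarrow> real" where
  "cbar t0 T C = time_avg t0 T (\<lambda>t. lambda_g_max C t / (hvar t)\<^sup>2)"

definition nbar :: "real \<Rightarrow> real \<Rightarrow> ('d::finite, 'n::finite) component \<Rightarrow> real" where
  "nbar t0 T C =
     time_avg t0 T (\<lambda>t. (alpha t)^4 * (noise_sd C)^4 / ((hvar t)\<^sup>2 * htilde C t))"

definition Gamma_obj ::
  "real \<Rightarrow> real \<Rightarrow> real \<Rightarrow> real \<Rightarrow>
   ('d1::finite, 'n::finite) component \<Rightarrow> ('d2::finite, 'n) component \<Rightarrow>
   real^'m^'n \<Rightarrow> real" where
  "Gamma_obj t0 T w1 w2 C1 C2 U =
     w1 * cbar t0 T C1 * (norm (perp_proj U ** loading C1))\<^sup>2 +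
     w2 * cbar t0 T C2 * (norm (perp_proj U ** loading C2))\<^sup>2"

definition M_mix ::
  "real \<Rightarrow> real \<Rightarrow> real \<Rightarrow> real \<Rightarrow>
   ('d1::finite, 'n::finite) component \<Rightarrow> ('d2::finite, 'n) component \<Rightarrow> real^'n^'n" where
  "M_mix t0 T w1 w2 C1 C2 =
     (w1 * cbar t0 T C1) *\<^sub>R (loading C1 ** transpose (loading C1)) +
     (w2 * cbar t0 T C2) *\<^sub>R (loading C2 ** transpose (loading C2))"

text \<open>
  Layers are numbered from 0: layer \<open>l\<close> is the affine map with weights \<open>W l\<close> and biases \<open>b l\<close> from
  \<open>N l\<close> to \<open>N (Suc l)\<close> neurons, and \<open>preact N W b x l\<close> is its output before activation.
\<close>

definition affine_layer ::
  "nat \<Rightarrow> (nat \<Rightarrow> nat \<Rightarrow> real) \<Rightarrow> (nat \<Rightarrow> real) \<Rightarrow> (nat \<Rightarrow> real) \<Rightarrow> nat \<Rightarrow> real" where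
  "affine_layer n W b x r = (\<Sum>c<n. W r c * x c) + b r"

primrec preact ::
  "(nat \<Rightarrow> nat) \<Rightarrow> (nat \<Rightarrow> nat \<Rightarrow> nat \<Rightarrow> real) \<Rightarrow> (nat \<Rightarrow> nat \<Rightarrow> real) \<Rightarrow>
   (nat \<Rightarrow> real) \<Rightarrow> nat \<Rightarrow> nat \<Rightarrow> real" where
  "preact N W b x 0 = affine_layer (N 0) (W 0) (b 0) x"
| "preact N W b x (Suc l) =
     affine_layer (N (Suc l)) (W (Suc l)) (b (Suc l)) (\<lambda>j. max 0 (preact N W b x l j))"

text \<open>
  Coordinates of \<open>real^'m\<close> are matched with neurons \<open>0, \<dots>, CARD('m) - 1\<close> by the library's
  enumeration \<open>to_nat_on UNIV\<close>; since weights may be permuted, the class below does not depend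
  on the enumeration chosen. Neuron \<open>CARD('m)\<close> of the input carries the time.
\<close>

definition net_input :: "real^'m \<Rightarrow> real \<Rightarrow> nat \<Rightarrow> real" where
  "net_input z t j =
     (if j < CARD('m) then z $ (from_nat_into UNIV j) else if j = CARD('m) then t else 0)"

definition relu_net ::
  "nat \<Rightarrow> (nat \<Rightarrow> nat) \<Rightarrow> (nat \<Rightarrow> nat \<Rightarrow> nat \<Rightarrow> real) \<Rightarrow> (nat \<Rightarrow> nat \<Rightarrow> real) \<Rightarrow>
   real^'m \<Rightarrow> real \<Rightarrow> real^'m" where
  "relu_net L N W b z t =
     (\<chi> i. preact N W b (net_input z t) (L - 1) (to_nat_on UNIV i))"

definition relu_class ::
  "real \<Rightarrow> nat \<Rightarrow> nat \<Rightarrow> nat \<Rightarrow> real \<Rightarrow> real \<Rightarrow> real \<Rightarrow> real \<Rightarrow>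
   (real^'m \<Rightarrow> real \<Rightarrow> real^'m) set" where
  "relu_class T L M J K \<kappa> \<gamma> \<gamma>t =
    {f. (\<exists>N W b. f = relu_net L N W b \<and>
          1 \<le> L \<and> N 0 = CARD('m) + 1 \<and> N L = CARD('m) \<and>
          (\<forall>l. 0 < l \<and> l < L \<longrightarrow> 1 \<le> N l \<and> N l \<le> M) \<and>
          (\<forall>l<L. \<forall>r<N (Suc l). \<bar>b l r\<bar> \<le> \<kappa> \<and> (\<forall>c<N l. \<bar>W l r c\<bar> \<le> \<kappa>)) \<and>
          (\<Sum>l<L. card {(r, c). r < N (Suc l) \<and> c < N l \<and> W l r c \<noteq> 0} +
                 card {r. r < N (Suc l) \<and> b l r \<noteq> 0}) \<le> J) \<and>
        (\<forall>z. \<forall>t\<in>{0..T}. norm (f z t) \<le> K) \<and>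
        (\<forall>t\<in>{0..T}. \<forall>z1 z2. norm (f z1 t - f z2 t) \<le> \<gamma> * norm (z1 - z2)) \<and>
        (\<forall>z. \<forall>t1\<in>{0..T}. \<forall>t2\<in>{0..T}. norm (f z t1 - f z t2) \<le> \<gamma>t * \<bar>t1 - t2\<bar>)}"

text \<open>
  Risks and error terms are integrals of nonnegative functions, taken in \<open>[0, \<infinity>]\<close>; an infimum
  over an empty class is \<open>\<infinity>\<close>.
\<close>

definition S_mix ::
  "(real^'m \<Rightarrow> real \<Rightarrow> real^'m) set \<Rightarrow> real^'m^'n \<Rightarrow> (real^'n \<Rightarrow> real \<Rightarrow> real^'n) set" where
  "S_mix F U =
     {\<lambda>x t. (1 / hvar t) *\<^sub>R (U *v f (transpose U *v x) t) - (1 / hvar t) *\<^sub>R x |f. f \<in> F}"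

definition L_mix ::
  "real \<Rightarrow> real \<Rightarrow> real \<Rightarrow> real \<Rightarrow>
   ('d1::finite, 'n::finite) component \<Rightarrow> ('d2::finite, 'n) component \<Rightarrow>
   (real^'n \<Rightarrow> real \<Rightarrow> real^'n) \<Rightarrow> ennreal" where
  "L_mix t0 T w1 w2 C1 C2 s =
     nn_time_avg t0 T (\<lambda>t.
       \<integral>\<^sup>+x. ennreal ((norm (s x t - grad (\<lambda>y. ln (mix_density w1 w2 C1 C2 t y)) x))\<^sup>2)
         \<partial>mix_law w1 w2 C1 C2 t)"

definition B_mix ::
  "real \<Rightarrow> real \<Rightarrow> real \<Rightarrow> real \<Rightarrow>
   ('d1::finite, 'n::finite) component \<Rightarrow> ('d2::finite, 'n) component \<Rightarrow>
   (real^'m \<Rightarrow> real \<Rightarrow> real^'m) set \<Rightarrow> real^'m^'n \<Rightarrow> ennreal" where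
  "B_mix t0 T w1 w2 C1 C2 F U = (INF s\<in>S_mix F U. L_mix t0 T w1 w2 C1 C2 s)"

definition post1 ::
  "real \<Rightarrow> real \<Rightarrow> ('d1::finite, 'n::finite) component \<Rightarrow> ('d2::finite, 'n) component \<Rightarrow>
   real^'n \<Rightarrow> real \<Rightarrow> real" where
  "post1 w1 w2 C1 C2 x t = w1 * fwd_density C1 t x / mix_density w1 w2 C1 C2 t x"

text \<open>
  The Lebesgue density of \<open>U\<^sup>T X\<^sub>t\<close>. It is determined up to null sets, and it occurs below only
  under integrals against laws of \<open>U\<^sup>T X\<^sub>t\<close>, which have Lebesgue densities when \<open>U\<close> has
  orthonormal columns.
\<close>

definition proj_density ::
  "('d::finite, 'n::finite) component \<Rightarrow> real^'m^'n \<Rightarrow> real \<Rightarrow> real^'m \<Rightarrow> real" where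
  "proj_density C U t z =
     enn2real (RN_deriv lborel (distr (fwd_law C t) borel (\<lambda>x. transpose U *v x)) z)"

definition proj_post1 ::
  "real \<Rightarrow> real \<Rightarrow> ('d1::finite, 'n::finite) component \<Rightarrow> ('d2::finite, 'n) component \<Rightarrow>
   real^'m^'n \<Rightarrow> real^'m \<Rightarrow> real \<Rightarrow> real" where
  "proj_post1 w1 w2 C1 C2 U z t =
     w1 * proj_density C1 U t z / (w1 * proj_density C1 U t z + w2 * proj_density C2 U t z)"

definition proj_post2 ::
  "real \<Rightarrow> real \<Rightarrow> ('d1::finite, 'n::finite) component \<Rightarrow> ('d2::finite, 'n) component \<Rightarrow>
   real^'m^'n \<Rightarrow> real^'m \<Rightarrow> real \<Rightarrow> real" where
  "proj_post2 w1 w2 C1 C2 U z t =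
     w2 * proj_density C2 U t z / (w1 * proj_density C1 U t z + w2 * proj_density C2 U t z)"

definition psi ::
  "('d::finite, 'n::finite) component \<Rightarrow> real^'m^'n \<Rightarrow> real^'m \<Rightarrow> real \<Rightarrow> real^'m" where
  "psi C U z t = (let H = transpose U ** loading C in H *v gfun C (pinv H *v z) t)"

definition f_comp ::
  "real \<Rightarrow> real \<Rightarrow> ('d1::finite, 'n::finite) component \<Rightarrow> ('d2::finite, 'n) component \<Rightarrow>
   real^'m^'n \<Rightarrow> real^'m \<Rightarrow> real \<Rightarrow> real^'m" where
  "f_comp w1 w2 C1 C2 U z t =
     proj_post1 w1 w2 C1 C2 U z t *\<^sub>R psi C1 U z t + proj_post2 w1 w2 C1 C2 U z t *\<^sub>R psi C2 U z t"

definition A_mix ::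
  "real \<Rightarrow> real \<Rightarrow> real \<Rightarrow> real \<Rightarrow>
   ('d1::finite, 'n::finite) component \<Rightarrow> ('d2::finite, 'n) component \<Rightarrow>
   (real^'m \<Rightarrow> real \<Rightarrow> real^'m) \<Rightarrow> real^'m^'n \<Rightarrow> ennreal" where
  "A_mix t0 T w1 w2 C1 C2 f U =
     nn_time_avg t0 T (\<lambda>t. ennreal (1 / (hvar t)\<^sup>2) *
       (\<integral>\<^sup>+x. ennreal ((norm (f (transpose U *v x) t -
                              f_comp w1 w2 C1 C2 U (transpose U *v x) t))\<^sup>2)
          \<partial>mix_law w1 w2 C1 C2 t))"

definition P_mix ::
  "real \<Rightarrow> real \<Rightarrow> real \<Rightarrow> real \<Rightarrow>
   ('d1::finite, 'n::finite) component \<Rightarrow> ('d2::finite, 'n) component \<Rightarrow>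
   real^'m^'n \<Rightarrow> ennreal" where
  "P_mix t0 T w1 w2 C1 C2 U =
     nn_time_avg t0 T (\<lambda>t. ennreal (1 / (hvar t)\<^sup>2) *
       (\<integral>\<^sup>+x. ennreal ((proj_post1 w1 w2 C1 C2 U (transpose U *v x) t - post1 w1 w2 C1 C2 x t)\<^sup>2 *
                     (norm (psi C1 U (transpose U *v x) t - psi C2 U (transpose U *v x) t))\<^sup>2)
          \<partial>mix_law w1 w2 C1 C2 t))"

end

theory Submission
  imports Defs
begin

text \<open>
  The ambient density of each component factors through its loading, so that
  \<open>h \<nabla>log p\<^sub>i(x) + x = A\<^sub>i g\<^sub>i(A\<^sub>i\<^sup>T x) + r\<^sub>i (x - A\<^sub>i A\<^sub>i\<^sup>T x)\<close> with \<open>r\<^sub>i = \<alpha>\<^sup>2 \<sigma>\<^sub>i\<^sup>2 / h\<^sub>i\<close>, where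
  \<open>h\<^sub>i\<close> is the variance \<open>htilde\<close>.
  When the column space of \<open>W\<close> contains that of \<open>A\<^sub>i\<close>, the first summand is \<open>W \<psi>\<^sub>i(W\<^sup>T x)\<close>. Hence \<open>h\<close>
  times the error of the score model given by \<open>f\<close>, with comparator \<open>f\<^sub>c\<close>, is
  \<open>W (f - f\<^sub>c) + (\<pi>\<^sub>1\<^sup>W - \<pi>\<^sub>1) W (\<psi>\<^sub>1 - \<psi>\<^sub>2) - \<Sum>\<^sub>i \<pi>\<^sub>i r\<^sub>i (W W\<^sup>T x - A\<^sub>i A\<^sub>i\<^sup>T x) - \<Sum>\<^sub>i \<pi>\<^sub>i r\<^sub>i (x - W W\<^sup>T x)\<close>,
  whose last sum is orthogonal to the rest. Young's inequality separates \<open>f - f\<^sub>c\<close>, convexity of the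
  squared norm handles the posterior weights, and the Gaussian second moments of the last two sums
  are \<open>h\<^sub>i (k - d\<^sub>i)\<close> and \<open>h\<^sub>i (D - k)\<close>.
\<close>

section \<open>Isotropic Gaussians\<close>

text \<open>The second moments do not depend on the latent law. Given \<open>z\<close>, the mean of
  X_t is \<open>alpha t *\<^sub>R (loading C *v z)\<close>, which lies in the column space of the
  loading and hence of \<open>W\<close>. Both projections that occur annihilate it, so only
  isotropic noise of variance \<open>htilde C t\<close> per dimension is left. With the coefficient
  r_i/h this gives r_i^2 h_i / h^2, the integrand of \<open>nbar\<close>.

  Convexity is applied with the posteriors given x, not those given the projection of x: the mixture
  density times such a posterior is a weight times a component density, so an expectation under the
  mixture turns into expectations under the components and the posteriors disappear.

  The noise in k - d_i dimensions shares the column space of \<open>W\<close> with the posterior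
  mismatch, and separating these two costs the factor 2. The D - k orthogonal dimensions do not pay
  it.

  All risks live in [0, \<infinity>], so an infinite mismatch or approximation error needs no
  separate treatment; what must be secured instead is measurability, before sums of integrals are
  split.\<close>

lemma gauss_nonneg [simp]: "0 \<le> gauss m v x"
  by (simp add: gauss_def)

lemma gauss_pos: "0 < v \<Longrightarrow> 0 < gauss m v x"
  by (simp add: gauss_def)

text \<open>All three arguments may vary: the mean is integrated over the latent law, and the
  variance depends on time.\<close>

lemma borel_measurable_gauss [measurable]:
  "(\<lambda>p. gauss (f p) (v p) (g p)) \<in> borel_measurable N"
  if [measurable]: "f \<in> borel_measurable N" "v \<in> borel_measurable N" "g \<in> borel_measurable N"
  for f g :: "'b \<Rightarrow> 'a::euclidean_space"
  unfolding gauss_def by measurable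

lemma borel_measurable_matrix_mult [measurable (raw)]:
  "(\<lambda>p. A *v f p) \<in> borel_measurable N" if "f \<in> borel_measurable N"
  for f :: "'b \<Rightarrow> real^'m" and A :: "real^'m^'n"
  by (rule measurable_compose[OF that])
    (intro borel_measurable_continuous_onI matrix_vector_mult_linear_continuous_on)

lemma norm_sq_eq_sum: "(norm y)\<^sup>2 = (\<Sum>b\<in>Basis. (y \<bullet> b)\<^sup>2)" for y :: "'a::euclidean_space"
  unfolding power2_norm_eq_inner by (subst euclidean_inner) (simp add: power2_eq_square)

text \<open>Reduces integrals to the one-dimensional \<open>normal_density\<close>, whose second
  parameter is a standard deviation; hence \<open>sqrt v\<close>.\<close>

lemma gauss_eq_prod:
  fixes m x :: "'a::euclidean_space"
  assumes "0 < v"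
  shows "gauss m v x = (\<Prod>b\<in>Basis. normal_density (m \<bullet> b) (sqrt v) (x \<bullet> b))"
proof -
  have e: "(2 * pi * v) powr (- real DIM('a) / 2) = (1 / sqrt (2 * pi * v)) ^ DIM('a)"
  proof -
    have "(1 / sqrt (2 * pi * v)) ^ DIM('a) = ((2 * pi * v) powr (- (1/2))) powr real DIM('a)"
      using assms by (simp add: powr_realpow powr_minus powr_half_sqrt divide_simps)
    also have "\<dots> = (2 * pi * v) powr (- real DIM('a) / 2)"
      by (subst powr_powr) (simp add: field_simps)
    finally show ?thesis by simp
  qed
  have "(\<Prod>b\<in>Basis. normal_density (m \<bullet> b) (sqrt v) (x \<bullet> b)) =
     (\<Prod>b\<in>(Basis::'a set). 1 / sqrt (2 * pi * v)) *
     (\<Prod>b\<in>Basis. exp (- ((x - m) \<bullet> b)\<^sup>2 / (2 * v)))"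
    using assms by (simp add: normal_density_def prod.distrib inner_diff_left prod_dividef power_one_over)
  also have "(\<Prod>b\<in>Basis. exp (- ((x - m) \<bullet> b)\<^sup>2 / (2 * v))) = exp (- (norm (x - m))\<^sup>2 / (2 * v))"
    by (simp add: exp_sum[symmetric] sum_divide_distrib sum_negf norm_sq_eq_sum)
  finally show ?thesis
    unfolding gauss_def e by simp
qed

lemma nn_integral_normal_density: "0 < s \<Longrightarrow> (\<integral>\<^sup>+x. ennreal (normal_density m s x) \<partial>lborel) = 1"
  by (subst nn_integral_eq_integral) auto

lemma nn_integral_normal_variance:
  assumes "0 < s"
  shows "(\<integral>\<^sup>+x. ennreal ((x - m)\<^sup>2 * normal_density m s x) \<partial>lborel) = ennreal (s\<^sup>2)"
proof (subst nn_integral_eq_integral)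
  show "integrable lborel (\<lambda>x. (x - m)\<^sup>2 * normal_density m s x)"
    using integrable_normal_moment[OF assms, of m 2] by (simp add: mult.commute)
  show "ennreal (\<integral>x. (x - m)\<^sup>2 * normal_density m s x \<partial>lborel) = ennreal (s\<^sup>2)"
    using integral_normal_moment_even[OF assms, of m 1] assms by (simp add: mult.commute)
qed auto

lemma nn_integral_gauss:
  fixes m :: "'a::euclidean_space"
  assumes "0 < v"
  shows "(\<integral>\<^sup>+x. ennreal (gauss m v x) \<partial>lborel) = 1"
proof -
  have "(\<integral>\<^sup>+x. ennreal (gauss m v x) \<partial>lborel) =
    (\<integral>\<^sup>+x. (\<Prod>b\<in>Basis. ennreal (normal_density (m \<bullet> b) (sqrt v) (x \<bullet> b))) \<partial>lborel)"
    by (simp add: gauss_eq_prod assms prod_ennreal)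
  also have "\<dots> = (\<Prod>b\<in>(Basis::'a set). \<integral>\<^sup>+x. ennreal (normal_density (m \<bullet> b) (sqrt v) x) \<partial>lborel)"
    by (rule nn_integral_lborel_prod) auto
  also have "\<dots> = 1"
    using assms by (simp add: nn_integral_normal_density)
  finally show ?thesis .
qed

lemma nn_integral_gauss_norm_sq:
  fixes m :: "'a::euclidean_space"
  assumes "0 < v"
  shows "(\<integral>\<^sup>+x. ennreal ((norm (x - m))\<^sup>2 * gauss m v x) \<partial>lborel) = ennreal (v * real DIM('a))"
proof -
  \<comment> \<open>Summand \<open>c\<close> puts the square into coordinate \<open>c\<close> alone,
    so it is still a product of one-variable functions; its integral is \<open>v\<close> from that
    coordinate times 1 from each of the others.\<close>
  let ?f = "\<lambda>c b x. if b = c then ennreal ((x - m \<bullet> b)\<^sup>2 * normal_density (m \<bullet> b) (sqrt v) x)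
    else ennreal (normal_density (m \<bullet> b) (sqrt v) x)"
  have "ennreal ((norm (x - m))\<^sup>2 * gauss m v x) = (\<Sum>c\<in>Basis. \<Prod>b\<in>Basis. ?f c b (x \<bullet> b))" for x
  proof -
    have "(norm (x - m))\<^sup>2 * gauss m v x = (\<Sum>c\<in>Basis. ((x - m) \<bullet> c)\<^sup>2 * gauss m v x)"
      by (simp add: sum_distrib_right[symmetric] norm_sq_eq_sum)
    also have "ennreal \<dots> = (\<Sum>c\<in>Basis. ennreal (((x - m) \<bullet> c)\<^sup>2 * gauss m v x))"
      by (subst sum_ennreal) auto
    also have "\<dots> = (\<Sum>c\<in>Basis. \<Prod>b\<in>Basis. ?f c b (x \<bullet> b))"
    proof (rule sum.cong[OF refl])
      fix c :: 'a assume c: "c \<in> Basis"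
      have "(\<Prod>b\<in>Basis. ?f c b (x \<bullet> b)) =
        ennreal (((x - m) \<bullet> c)\<^sup>2 * normal_density (m \<bullet> c) (sqrt v) (x \<bullet> c)) *
        (\<Prod>b\<in>Basis - {c}. ennreal (normal_density (m \<bullet> b) (sqrt v) (x \<bullet> b)))"
        using c by (subst prod.remove[of _ c]) (auto simp: inner_diff_left intro!: prod.cong)
      also have "\<dots> = ennreal (((x - m) \<bullet> c)\<^sup>2 * gauss m v x)"
        using c by (simp add: gauss_eq_prod assms prod.remove[of _ c] prod_ennreal
            ennreal_mult[symmetric] prod_nonneg mult.assoc)
      finally show "ennreal (((x - m) \<bullet> c)\<^sup>2 * gauss m v x) = (\<Prod>b\<in>Basis. ?f c b (x \<bullet> b))"
        by simp
    qed
    finally show ?thesis .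
  qed
  then have "(\<integral>\<^sup>+x. ennreal ((norm (x - m))\<^sup>2 * gauss m v x) \<partial>lborel) =
     (\<integral>\<^sup>+x. (\<Sum>c\<in>Basis. \<Prod>b\<in>Basis. ?f c b (x \<bullet> b)) \<partial>lborel)"
    by simp
  also have "\<dots> = (\<Sum>c\<in>Basis. (\<integral>\<^sup>+x. (\<Prod>b\<in>Basis. ?f c b (x \<bullet> b)) \<partial>lborel))"
    by (rule nn_integral_sum) measurable
  also have "\<dots> = (\<Sum>c\<in>(Basis::'a set). ennreal v)"
  proof (rule sum.cong[OF refl])
    fix c :: 'a assume c: "c \<in> Basis"
    have "(\<integral>\<^sup>+x. (\<Prod>b\<in>Basis. ?f c b (x \<bullet> b)) \<partial>lborel) = (\<Prod>b\<in>Basis. (\<integral>\<^sup>+x. ?f c b x \<partial>lborel))"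
      by (rule nn_integral_lborel_prod) auto
    also have "\<dots> = (\<Prod>b\<in>Basis. if b = c then ennreal v else 1)"
      using assms by (intro prod.cong) (auto simp: nn_integral_normal_density nn_integral_normal_variance)
    also have "\<dots> = ennreal v"
      using c by (simp add: prod.delta)
    finally show "(\<integral>\<^sup>+x. (\<Prod>b\<in>Basis. ?f c b (x \<bullet> b)) \<partial>lborel) = ennreal v" .
  qed
  also have "\<dots> = ennreal (v * real DIM('a))"
    using assms by (simp add: ennreal_mult ennreal_of_nat_eq_real_of_nat mult.commute)
  finally show ?thesis .
qed

lemma nn_integral_lborel_translate:
  fixes f :: "'a::euclidean_space \<Rightarrow> ennreal"
  assumes [measurable]: "f \<in> borel_measurable borel"
  shows "(\<integral>\<^sup>+x. f (x + c) \<partial>lborel) = (\<integral>\<^sup>+x. f x \<partial>lborel)"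
proof -
  have "(\<integral>\<^sup>+x. f x \<partial>lborel) = (\<integral>\<^sup>+x. f x \<partial>distr lborel borel ((+) c))"
    by (simp add: lborel_distr_plus)
  also have "\<dots> = (\<integral>\<^sup>+x. f (x + c) \<partial>lborel)"
    by (subst nn_integral_distr) (auto simp: add.commute)
  finally show ?thesis by simp
qed

text \<open>Complete the square in \<open>e\<close>.\<close>

lemma gauss_product:
  fixes m x e :: "'a::euclidean_space"
  assumes "0 < u" "0 < s" and V: "V = a\<^sup>2 * s + u"
  shows "gauss (a *\<^sub>R (m + e)) u x * gauss 0 s e =
    gauss (a *\<^sub>R m) V x * gauss ((a * s / V) *\<^sub>R (x - a *\<^sub>R m)) (u * s / V) e"
proof -
  have Vp: "0 < V" using assms by (simp add: add_nonneg_pos)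
  define y where "y = x - a *\<^sub>R m"
  have n: "(norm (y - a *\<^sub>R e))\<^sup>2 / (2 * u) + (norm e)\<^sup>2 / (2 * s) =
     (norm y)\<^sup>2 / (2 * V) + (norm (e - (a * s / V) *\<^sub>R y))\<^sup>2 / (2 * (u * s / V))"
  proof -
    define p q r where "p = y \<bullet> y" and "q = y \<bullet> e" and "r = e \<bullet> e"
    have "(norm (y - a *\<^sub>R e))\<^sup>2 = p - 2 * a * q + a\<^sup>2 * r"
      unfolding power2_norm_eq_inner p_def q_def r_def
      by (simp add: inner_diff inner_commute power2_eq_square algebra_simps)
    moreover have "(norm (e - (a * s / V) *\<^sub>R y))\<^sup>2 = r - 2 * (a * s / V) * q + (a * s / V)\<^sup>2 * p"
      unfolding power2_norm_eq_inner p_def q_def r_def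
      by (simp add: inner_diff inner_commute power2_eq_square algebra_simps)
    moreover have "(p - 2 * a * q + a\<^sup>2 * r) / (2 * u) + r / (2 * s) =
      p / (2 * V) + (r - 2 * (a * s / V) * q + (a * s / V)\<^sup>2 * p) / (2 * (u * s / V))"
    proof -
      have "(p - 2 * a * q + a\<^sup>2 * r) / (2 * u) + r / (2 * s) = (p * s - 2 * a * s * q + V * r) / (2 * u * s)"
        using assms by (simp add: field_simps)
      moreover have "p / (2 * V) + (r - 2 * (a * s / V) * q + (a * s / V)\<^sup>2 * p) / (2 * (u * s / V)) =
         (p * (u * s + (a * s)\<^sup>2) / V - 2 * a * s * q + V * r) / (2 * u * s)"
        using assms(1,2) Vp by (simp add: divide_simps power2_eq_square) (simp add: algebra_simps)
      moreover have "u * s + (a * s)\<^sup>2 = s * V"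
        by (simp add: V power2_eq_square algebra_simps)
      ultimately show ?thesis
        using Vp by simp
    qed
    ultimately show ?thesis by (simp add: p_def r_def power2_norm_eq_inner)
  qed
  have c: "(2 * pi * u) powr d * (2 * pi * s) powr d = (2 * pi * V) powr d * (2 * pi * (u * s / V)) powr d"
    for d using assms(1,2) Vp by (simp add: powr_mult[symmetric] mult_ac)
  have "gauss (a *\<^sub>R (m + e)) u x * gauss 0 s e = (2 * pi * u) powr (- real DIM('a) / 2) *
     (2 * pi * s) powr (- real DIM('a) / 2) *
     exp (- ((norm (y - a *\<^sub>R e))\<^sup>2 / (2 * u) + (norm e)\<^sup>2 / (2 * s)))"
    by (simp add: gauss_def y_def scaleR_add_right diff_diff_eq exp_add[symmetric] exp_diff exp_minus divide_simps)
  also have "\<dots> = gauss (a *\<^sub>R m) V x * gauss ((a * s / V) *\<^sub>R (x - a *\<^sub>R m)) (u * s / V) e"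
    unfolding c n by (simp add: gauss_def y_def exp_add[symmetric] exp_diff exp_minus divide_simps)
  finally show ?thesis .
qed

section \<open>Projections onto the span of orthonormal columns\<close>

text \<open>As a simp rule this turns \<open>transpose A *v x\<close> into \<open>x v* A\<close> and
  would destroy the form that the projection lemmas match.\<close>

declare transpose_matrix_vector [simp del]

lemma inner_transpose_mult: "(transpose A *v x) \<bullet> y = x \<bullet> (A *v y)"
  for A :: "real^'m^'n"
  by (simp add: transpose_matrix_vector dot_lmul_matrix)

lemma inner_mult_transpose: "(A *v x) \<bullet> y = x \<bullet> (transpose A *v y)"
  for A :: "real^'m^'n"
  using inner_transpose_mult[of A y x] by (simp add: inner_commute)

lemma transpose_mult_orthonormal:
  "orthonormal_cols U \<Longrightarrow> transpose U *v (U *v z) = z"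
  by (simp add: orthonormal_cols_def matrix_vector_mul_assoc)

lemma norm_orthonormal_mult: "orthonormal_cols U \<Longrightarrow> norm (U *v z) = norm z"
  by (simp add: norm_eq_sqrt_inner inner_mult_transpose transpose_mult_orthonormal)

lemma norm_sq_orthonormal_split:
  assumes "orthonormal_cols U"
  shows "(norm x)\<^sup>2 = (norm (transpose U *v x))\<^sup>2 + (norm (x - U *v (transpose U *v x)))\<^sup>2"
proof -
  let ?p = "U *v (transpose U *v x)"
  have "?p \<bullet> (x - ?p) = 0"
    by (simp add: inner_mult_transpose matrix_vector_mult_diff_distrib transpose_mult_orthonormal[OF assms])
  then have "(norm x)\<^sup>2 = (norm ?p)\<^sup>2 + (norm (x - ?p))\<^sup>2"
    using norm_add_Pythagorean[of ?p "x - ?p"] by (simp add: orthogonal_def)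
  then show ?thesis
    by (simp add: norm_orthonormal_mult[OF assms])
qed

text \<open>Pythagoras splits the exponent. The first two factors form the Gaussian of the D - k
  orthogonal dimensions; they serve both to compute marginals and to factor the density of a
  component.\<close>

lemma gauss_orthonormal_split:
  fixes U :: "real^'k^'n"
  assumes "orthonormal_cols U" "0 < v"
  shows "gauss m v x = (2 * pi * v) powr (- (real CARD('n) - real CARD('k)) / 2) *
      exp (- (norm ((x - m) - U *v (transpose U *v (x - m))))\<^sup>2 / (2 * v)) *
      gauss (transpose U *v m) v (transpose U *v x)"
proof -
  have "(2 * pi * v) powr (- real CARD('n) / 2) =
    (2 * pi * v) powr (- (real CARD('n) - real CARD('k)) / 2) * (2 * pi * v) powr (- real CARD('k) / 2)"
    by (simp add: powr_add[symmetric] field_simps)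
  moreover have "exp (- (norm (x - m))\<^sup>2 / (2 * v)) =
      exp (- (norm ((x - m) - U *v (transpose U *v (x - m))))\<^sup>2 / (2 * v)) *
      exp (- (norm (transpose U *v x - transpose U *v m))\<^sup>2 / (2 * v))"
    by (subst norm_sq_orthonormal_split[OF assms(1), of "x - m"], subst exp_add[symmetric])
      (simp add: matrix_vector_mult_diff_distrib diff_divide_distrib)
  ultimately show ?thesis
    unfolding gauss_def by simp
qed

text \<open>
  Shifting \<open>x\<close> by \<open>U z\<close> shifts \<open>U\<^sup>T x\<close> by \<open>z\<close> and fixes the orthogonal part. Averaging these
  shifts over a Gaussian weight in \<open>z\<close> reduces the marginal to translation invariance and Tonelli,
  with no change of variables by a rotation.
\<close>

lemma nn_integral_gauss_proj:
  fixes U :: "real^'k^'n" and F :: "real^'k \<Rightarrow> ennreal"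
  assumes U: "orthonormal_cols U" and v: "0 < v" and [measurable]: "F \<in> borel_measurable borel"
  shows "(\<integral>\<^sup>+x. F (transpose U *v x) * ennreal (gauss m v x) \<partial>lborel) =
         (\<integral>\<^sup>+z. F z * ennreal (gauss (transpose U *v m) v z) \<partial>lborel)"
proof -
  define e where "e x = (2 * pi * v) powr (- (real CARD('n) - real CARD('k)) / 2) *
      exp (- (norm ((x - m) - U *v (transpose U *v (x - m))))\<^sup>2 / (2 * v))" for x
  define p where "p = (\<lambda>x. transpose U *v x)"
  define g where "g = gauss (p m) v"
  \<comment> \<open>The averaging weight is the mirror image of \<open>g\<close>, so that
    \<open>k (- p x)\<close> is the factor \<open>g (p x)\<close> needed to rebuild
    \<open>gauss m v x\<close> from \<open>e x\<close>.\<close>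
  define k where "k = gauss (- p m) v"
  have [measurable]: "e \<in> borel_measurable borel" unfolding e_def by measurable
  have [measurable]: "p \<in> borel_measurable borel" unfolding p_def by measurable
  have [measurable]: "g \<in> borel_measurable borel" unfolding g_def by measurable
  have [measurable]: "k \<in> borel_measurable borel" unfolding k_def by measurable
  have e0: "0 \<le> e x" for x by (simp add: e_def)
  have gn: "gauss m v x = e x * g (p x)" for x
    unfolding e_def g_def p_def by (rule gauss_orthonormal_split[OF U v])
  have p_shift: "p (x + U *v z) = p x + z" for x z
    by (simp add: p_def matrix_vector_right_distrib transpose_mult_orthonormal[OF U])
  have e_shift: "e (x + U *v z) = e x" for x z
    by (simp add: e_def matrix_vector_right_distrib matrix_vector_mult_diff_distrib
        transpose_mult_orthonormal[OF U] algebra_simps)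
  have k_neg: "k (- p x) = g (p x)" for x
    by (simp add: k_def g_def gauss_def norm_minus_commute)
  have "(\<integral>\<^sup>+x. F (p x) * ennreal (gauss m v x) \<partial>lborel) =
      (\<integral>\<^sup>+z. ennreal (k z) * (\<integral>\<^sup>+x. F (p x) * ennreal (gauss m v x) \<partial>lborel) \<partial>lborel)"
    by (subst nn_integral_multc) (simp_all add: k_def nn_integral_gauss v)
  also have "\<dots> = (\<integral>\<^sup>+z. ennreal (k z) * (\<integral>\<^sup>+x. F (p x + z) * (ennreal (e x) * ennreal (g (p x + z))) \<partial>lborel) \<partial>lborel)"
  proof (rule nn_integral_cong)
    fix z
    have "(\<integral>\<^sup>+x. F (p x) * ennreal (gauss m v x) \<partial>lborel) =
       (\<integral>\<^sup>+x. F (p x + z) * (ennreal (e x) * ennreal (g (p x + z))) \<partial>lborel)"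
      by (subst nn_integral_lborel_translate[of _ "U *v z", symmetric])
        (simp_all add: gn p_shift e_shift ennreal_mult e0 g_def)
    then show "ennreal (k z) * (\<integral>\<^sup>+x. F (p x) * ennreal (gauss m v x) \<partial>lborel) =
       ennreal (k z) * (\<integral>\<^sup>+x. F (p x + z) * (ennreal (e x) * ennreal (g (p x + z))) \<partial>lborel)"
      by simp
  qed
  also have "\<dots> = (\<integral>\<^sup>+z. (\<integral>\<^sup>+x. ennreal (k z) * (F (p x + z) * (ennreal (e x) * ennreal (g (p x + z)))) \<partial>lborel) \<partial>lborel)"
    by (subst nn_integral_cmult) auto
  also have "\<dots> = (\<integral>\<^sup>+x. (\<integral>\<^sup>+z. ennreal (k z) * (F (p x + z) * (ennreal (e x) * ennreal (g (p x + z)))) \<partial>lborel) \<partial>lborel)"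
    by (rule lborel_pair.Fubini') measurable
  \<comment> \<open>Substitute \<open>w = p x + z\<close>; the argument of \<open>F\<close> then no
    longer involves \<open>x\<close>.\<close>
  also have "\<dots> = (\<integral>\<^sup>+x. (\<integral>\<^sup>+w. ennreal (k (w - p x)) * (F w * (ennreal (e x) * ennreal (g w))) \<partial>lborel) \<partial>lborel)"
  proof (rule nn_integral_cong)
    fix x
    show "(\<integral>\<^sup>+z. ennreal (k z) * (F (p x + z) * (ennreal (e x) * ennreal (g (p x + z)))) \<partial>lborel) =
      (\<integral>\<^sup>+w. ennreal (k (w - p x)) * (F w * (ennreal (e x) * ennreal (g w))) \<partial>lborel)"
      by (subst (2) nn_integral_lborel_translate[of _ "p x", symmetric]) (simp_all add: add.commute)
  qed
  also have "\<dots> = (\<integral>\<^sup>+w. (\<integral>\<^sup>+x. ennreal (k (w - p x)) * (F w * (ennreal (e x) * ennreal (g w))) \<partial>lborel) \<partial>lborel)"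
    by (rule lborel_pair.Fubini') measurable
  also have "\<dots> = (\<integral>\<^sup>+w. (F w * ennreal (g w)) * (\<integral>\<^sup>+x. ennreal (k (w - p x)) * ennreal (e x) \<partial>lborel) \<partial>lborel)"
    by (subst nn_integral_cmult[symmetric]) (auto simp: mult_ac)
  also have "\<dots> = (\<integral>\<^sup>+w. F w * ennreal (g w) \<partial>lborel)"
  proof (rule nn_integral_cong)
    fix w
    \<comment> \<open>Shifting \<open>x\<close> by \<open>U *v w\<close> cancels \<open>w\<close> in
      \<open>k\<close>, and what remains is the full Gaussian of mass 1.\<close>
    have "(\<integral>\<^sup>+x. ennreal (k (w - p x)) * ennreal (e x) \<partial>lborel) =
      (\<integral>\<^sup>+x. ennreal (k (- p x)) * ennreal (e x) \<partial>lborel)"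
      by (subst nn_integral_lborel_translate[of _ "U *v w", symmetric]) (simp_all add: p_shift e_shift)
    also have "\<dots> = (\<integral>\<^sup>+x. ennreal (gauss m v x) \<partial>lborel)"
      by (simp add: k_neg gn ennreal_mult[symmetric] e0 g_def mult.commute)
    finally show "F w * ennreal (g w) * (\<integral>\<^sup>+x. ennreal (k (w - p x)) * ennreal (e x) \<partial>lborel) = F w * ennreal (g w)"
      by (simp add: nn_integral_gauss v)
  qed
  finally show ?thesis by (simp add: p_def g_def)
qed

text \<open>Tested against a standard Gaussian, the preimage of a null set has the mass that the
  Gaussian marginal gives to the null set, namely 0; the Gaussian density vanishes nowhere, so the
  preimage is Lebesgue null. This lifts almost-everywhere facts about projected densities to the
  ambient space.\<close>

lemma AE_lborel_transpose_mult:
  fixes U :: "real^'k^'n"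
  assumes U: "orthonormal_cols U" and "AE z in lborel. Q z"
  shows "AE x in lborel. Q (transpose U *v x)"
proof -
  obtain N where N: "{z \<in> space lborel. \<not> Q z} \<subseteq> N" "emeasure lborel N = 0" "N \<in> sets lborel"
    using assms(2) by (rule AE_E)
  then have [measurable]: "N \<in> sets borel" and null: "N \<in> null_sets lborel"
    by (auto simp: null_setsI)
  have "(\<integral>\<^sup>+x. indicator N (transpose U *v x) * ennreal (gauss 0 1 x) \<partial>lborel) =
     (\<integral>\<^sup>+z. indicator N z * ennreal (gauss (transpose U *v 0) 1 z) \<partial>lborel)"
    by (rule nn_integral_gauss_proj[OF U]) auto
  also have "\<dots> = (\<integral>\<^sup>+(z::real^'k). 0 \<partial>lborel)"
    by (rule nn_integral_cong_AE, rule eventually_mono[OF AE_not_in[OF null]]) simp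
  finally have *: "(\<integral>\<^sup>+x. indicator N (transpose U *v x) * ennreal (gauss 0 1 x) \<partial>lborel) = 0"
    by simp
  have "AE x in lborel. indicator N (transpose U *v x) * ennreal (gauss 0 1 x) = 0"
    by (rule nn_integral_0_iff_AE[THEN iffD1, OF _ *]) measurable
  then show ?thesis
  proof (rule eventually_mono)
    fix x assume "indicator N (transpose U *v x) * ennreal (gauss 0 1 x) = 0"
    moreover have "ennreal (gauss 0 1 x) \<noteq> 0"
      using gauss_pos[of 1 0 x] by simp
    ultimately have "transpose U *v x \<notin> N"
      by (metis indicator_simps(1) mult_1)
    then show "Q (transpose U *v x)" using N(1) by auto
  qed
qed

lemma nn_integral_gauss_proj_norm_sq:
  fixes U :: "real^'k^'n"
  assumes U: "orthonormal_cols U" and v: "0 < v"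
  shows "(\<integral>\<^sup>+x. ennreal ((norm (transpose U *v (x - m)))\<^sup>2) * ennreal (gauss m v x) \<partial>lborel) =
    ennreal (v * real CARD('k))"
proof -
  have "(\<integral>\<^sup>+x. ennreal ((norm (transpose U *v x - transpose U *v m))\<^sup>2) * ennreal (gauss m v x) \<partial>lborel) =
    (\<integral>\<^sup>+z. ennreal ((norm (z - transpose U *v m))\<^sup>2) * ennreal (gauss (transpose U *v m) v z) \<partial>lborel)"
    by (rule nn_integral_gauss_proj[OF U v]) measurable
  then show ?thesis
    using nn_integral_gauss_norm_sq[OF v, of "transpose U *v m"]
    by (simp add: matrix_vector_mult_diff_distrib ennreal_mult)
qed

text \<open>Moments of complementary projections are obtained by subtraction in Pythagoras'
  identity; this is legitimate in \<open>ennreal\<close> because the subtracted integral is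
  finite.\<close>

lemma nn_integral_diff_real:
  assumes [measurable]: "f \<in> borel_measurable M" "g \<in> borel_measurable M" "h \<in> borel_measurable M"
    and "\<And>x. h x = f x + g x" "integral\<^sup>N M f = ennreal a" "integral\<^sup>N M h = ennreal b" "0 \<le> a"
  shows "integral\<^sup>N M g = ennreal (b - a)"
proof -
  have "ennreal b = ennreal a + integral\<^sup>N M g"
    using assms(4-6) nn_integral_add[OF assms(1,2)] by (simp cong: nn_integral_cong)
  then have "integral\<^sup>N M g = ennreal b - ennreal a" by simp
  then show ?thesis using assms(7) by (simp add: ennreal_minus)
qed

lemma nn_integral_gauss_perp_norm_sq:
  fixes U :: "real^'k^'n"
  assumes U: "orthonormal_cols U" and v: "0 < v"
  shows "(\<integral>\<^sup>+x. ennreal ((norm ((x - m) - U *v (transpose U *v (x - m))))\<^sup>2) * ennreal (gauss m v x) \<partial>lborel) =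
    ennreal (v * (real CARD('n) - real CARD('k)))"
proof -
  have "(\<integral>\<^sup>+x. ennreal ((norm ((x - m) - U *v (transpose U *v (x - m))))\<^sup>2) * ennreal (gauss m v x) \<partial>lborel) =
    ennreal (v * real CARD('n) - v * real CARD('k))"
  proof (rule nn_integral_diff_real[OF _ _ _ _ nn_integral_gauss_proj_norm_sq[OF U v] nn_integral_gauss_norm_sq[OF v, of m, simplified]])
    show "ennreal ((norm (x - m))\<^sup>2 * gauss m v x) =
        ennreal ((norm (transpose U *v (x - m)))\<^sup>2) * ennreal (gauss m v x) +
        ennreal ((norm ((x - m) - U *v (transpose U *v (x - m))))\<^sup>2) * ennreal (gauss m v x)" for x
      by (simp add: norm_sq_orthonormal_split[OF U, of "x - m"] ennreal_mult distrib_right)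
    show "0 \<le> v * real CARD('k)" using v by simp
  qed measurable
  then show ?thesis by (simp add: right_diff_distrib)
qed

text \<open>As \<open>W\<close> fixes the columns of \<open>A\<close>, the difference of the two
  projections is the orthogonal projection onto a space of dimension k - d. Taking adjoints gives
  \<open>AW\<close>, so Pythagoras with respect to \<open>A\<close>, applied to the projection of
  \<open>x - m\<close> by \<open>W\<close>, leaves exactly this difference.\<close>

lemma nn_integral_gauss_nested_norm_sq:
  fixes W :: "real^'k^'n" and A :: "real^'d^'n"
  assumes W: "orthonormal_cols W" and A: "orthonormal_cols A"
    and WA: "\<And>z. W *v (transpose W *v (A *v z)) = A *v z" and v: "0 < v"
  shows "(\<integral>\<^sup>+x. ennreal ((norm (W *v (transpose W *v (x - m)) - A *v (transpose A *v (x - m))))\<^sup>2) *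
      ennreal (gauss m v x) \<partial>lborel) = ennreal (v * (real CARD('k) - real CARD('d)))"
proof -
  have AW: "transpose A *v (W *v (transpose W *v y)) = transpose A *v y" for y
  proof (rule vector_eq_rdot[THEN iffD1], rule allI)
    fix z
    show "(transpose A *v (W *v (transpose W *v y))) \<bullet> z = (transpose A *v y) \<bullet> z"
      by (metis WA inner_transpose_mult inner_commute)
  qed
  have "(\<integral>\<^sup>+x. ennreal ((norm (W *v (transpose W *v (x - m)) - A *v (transpose A *v (x - m))))\<^sup>2) *
      ennreal (gauss m v x) \<partial>lborel) = ennreal (v * real CARD('k) - v * real CARD('d))"
  proof (rule nn_integral_diff_real[OF _ _ _ _ nn_integral_gauss_proj_norm_sq[OF A v] nn_integral_gauss_proj_norm_sq[OF W v]])
    show "ennreal ((norm (transpose W *v (x - m)))\<^sup>2) * ennreal (gauss m v x) =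
        ennreal ((norm (transpose A *v (x - m)))\<^sup>2) * ennreal (gauss m v x) +
        ennreal ((norm (W *v (transpose W *v (x - m)) - A *v (transpose A *v (x - m))))\<^sup>2) *
          ennreal (gauss m v x)" for x
      using norm_sq_orthonormal_split[OF A, of "W *v (transpose W *v (x - m))"]
      by (simp add: AW norm_orthonormal_mult[OF W] distrib_right)
    show "0 \<le> v * real CARD('d)" using v by simp
  qed measurable
  then show ?thesis by (simp add: right_diff_distrib)
qed

section \<open>Differentiating Gaussian mixtures\<close>

lemma gauss_le:
  fixes m x :: "'a::euclidean_space"
  assumes "0 < v"
  shows "gauss m v x \<le> (2 * pi * v) powr (- real DIM('a) / 2)"
  using assms by (simp add: gauss_def mult_left_le)

lemma mult_exp_neg_le_one: "s * exp (- s) \<le> 1" for s :: real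
proof -
  have "s \<le> exp s" using exp_ge_add_one_self[of s] by linarith
  then show ?thesis by (simp add: exp_minus field_simps)
qed

text \<open>Uniformity in \<open>m\<close> makes the gradient integrand below bounded, hence
  integrable against every latent law, without a moment of that law.\<close>

lemma norm_sq_mult_gauss_le:
  fixes m x :: "'a::euclidean_space"
  assumes "0 < v"
  shows "(norm (x - m))\<^sup>2 * gauss m v x \<le> 2 * v * (2 * pi * v) powr (- real DIM('a) / 2)"
proof -
  let ?s = "(norm (x - m))\<^sup>2 / (2 * v)"
  have "(norm (x - m))\<^sup>2 * gauss m v x = 2 * v * (2 * pi * v) powr (- real DIM('a) / 2) * (?s * exp (- ?s))"
    using assms by (simp add: gauss_def)
  also have "\<dots> \<le> 2 * v * (2 * pi * v) powr (- real DIM('a) / 2) * 1"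
    using assms by (intro mult_left_mono mult_exp_neg_le_one) auto
  finally show ?thesis by simp
qed

text \<open>
  The constant does not depend on \<open>m\<close>, so integrating over \<open>m\<close> differentiates a mixture without
  dominated convergence.
\<close>

lemma gauss_taylor_bound:
  fixes m x k :: "'a::euclidean_space"
  assumes v: "0 < v"
  shows "\<bar>gauss m v (x + k) - gauss m v x - ((gauss m v x / v) *\<^sub>R (m - x)) \<bullet> k\<bar>
    \<le> 3 * (2 * pi * v) powr (- real DIM('a) / 2) / v * (norm k)\<^sup>2"
proof -
  define w where "w = x - m"
  define c where "c = (2 * pi * v) powr (- real DIM('a) / 2)"
  \<comment> \<open>Everything is restricted to the segment from \<open>x\<close> to
    \<open>x + k\<close>: \<open>q s\<close> is the squared distance to \<open>m\<close> at
    parameter \<open>s\<close>, and \<open>th\<close> is the exponential along the segment.\<close>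
  define q where "q s = w \<bullet> w + 2 * s * (w \<bullet> k) + s\<^sup>2 * (k \<bullet> k)" for s
  define q' where "q' s = 2 * (w \<bullet> k) + 2 * s * (k \<bullet> k)" for s
  define th where "th s = exp (- q s / (2 * v))" for s
  define diff where "diff = (\<lambda>i::nat. if i = 0 then th else if i = 1 then (\<lambda>s. - q' s / (2 * v) * th s)
     else (\<lambda>s. ((q' s)\<^sup>2 / (4 * v\<^sup>2) - (k \<bullet> k) / v) * th s))"
  have q: "q s = (norm (w + s *\<^sub>R k))\<^sup>2" for s
    unfolding q_def power2_norm_eq_inner
    by (simp add: inner_add inner_commute power2_eq_square algebra_simps)
  have q': "q' s = 2 * ((w + s *\<^sub>R k) \<bullet> k)" for s
    by (simp add: q'_def inner_add_left)
  have dq: "(q has_real_derivative q' s) (at s)" for s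
    unfolding q_def q'_def by (auto intro!: derivative_eq_intros)
  have dq': "(q' has_real_derivative 2 * (k \<bullet> k)) (at s)" for s
    unfolding q'_def by (auto intro!: derivative_eq_intros)
  have dth: "(th has_real_derivative (- q' s / (2 * v) * th s)) (at s)" for s
    unfolding th_def by (rule derivative_eq_intros refl dq | use v in simp)+
  have dth': "((\<lambda>s. - q' s / (2 * v) * th s) has_real_derivative
      ((q' s)\<^sup>2 / (4 * v\<^sup>2) - (k \<bullet> k) / v) * th s) (at s)" for s
    by (rule derivative_eq_intros refl dq' dth | use v in \<open>simp add: field_simps power2_eq_square\<close>)+
  \<comment> \<open>The constant is 3 = 2 + 1. Cauchy-Schwarz gives
    \<open>(q' s)\<^sup>2 \<le> 4 * q s * (norm k)\<^sup>2\<close>, and the exponential absorbs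
    \<open>q s\<close> at the cost of \<open>2 / v\<close>; the other term costs
    \<open>1 / v\<close> because \<open>th s \<le> 1\<close>.\<close>
  have bound: "\<bar>((q' s)\<^sup>2 / (4 * v\<^sup>2) - (k \<bullet> k) / v) * th s\<bar> \<le> 3 / v * (norm k)\<^sup>2" for s
  proof -
    have "(q' s)\<^sup>2 \<le> 4 * q s * (norm k)\<^sup>2"
    proof -
      have "\<bar>q' s\<bar> \<le> 2 * (norm (w + s *\<^sub>R k) * norm k)"
        unfolding q' using Cauchy_Schwarz_ineq2[of "w + s *\<^sub>R k" k] by (simp add: abs_mult)
      then have "\<bar>q' s\<bar>\<^sup>2 \<le> (2 * (norm (w + s *\<^sub>R k) * norm k))\<^sup>2"
        by (rule power_mono) simp
      then show ?thesis by (simp add: q power_mult_distrib)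
    qed
    then have "(q' s)\<^sup>2 / (4 * v\<^sup>2) * th s \<le> (4 * q s * (norm k)\<^sup>2) / (4 * v\<^sup>2) * th s"
      by (intro mult_right_mono divide_right_mono) (auto simp: th_def)
    also have "\<dots> = 2 / v * (norm k)\<^sup>2 * (q s / (2 * v) * exp (- (q s / (2 * v))))"
      using v by (simp add: th_def power2_eq_square)
    also have "\<dots> \<le> 2 / v * (norm k)\<^sup>2 * 1"
      using v by (intro mult_left_mono mult_exp_neg_le_one) auto
    finally have 1: "(q' s)\<^sup>2 / (4 * v\<^sup>2) * th s \<le> 2 / v * (norm k)\<^sup>2" by simp
    have "th s \<le> 1" unfolding th_def using v by (simp add: q)
    then have 2: "(k \<bullet> k) / v * th s \<le> (norm k)\<^sup>2 / v * 1"
      using v by (intro mult_mono) (auto simp: power2_norm_eq_inner th_def)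
    have 3: "0 \<le> (q' s)\<^sup>2 / (4 * v\<^sup>2) * th s" "0 \<le> (k \<bullet> k) / v * th s"
      using v by (auto simp: th_def)
    have "((q' s)\<^sup>2 / (4 * v\<^sup>2) - (k \<bullet> k) / v) * th s = (q' s)\<^sup>2 / (4 * v\<^sup>2) * th s - (k \<bullet> k) / v * th s"
      by (rule left_diff_distrib)
    moreover have "3 / v * (norm k)\<^sup>2 = 2 / v * (norm k)\<^sup>2 + (norm k)\<^sup>2 / v"
      by (simp add: divide_simps)
    ultimately show ?thesis using 1 2 3 by simp
  qed
  have "\<exists>s. 0 < s \<and> s < 1 \<and> th 1 = (\<Sum>m<2. diff m 0 / fact m * 1 ^ m) + diff 2 s / fact 2 * 1 ^ 2"
  proof (rule Maclaurin)
    show "\<forall>m t. m < 2 \<and> 0 \<le> t \<and> t \<le> 1 \<longrightarrow> (diff m has_real_derivative diff (Suc m) t) (at t)"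
    proof (intro allI impI)
      fix m :: nat and t :: real assume "m < 2 \<and> 0 \<le> t \<and> t \<le> 1"
      then have "m = 0 \<or> m = 1" by auto
      then show "(diff m has_real_derivative diff (Suc m) t) (at t)"
        using dth dth' by (auto simp: diff_def)
    qed
  qed (auto simp: diff_def)
  then obtain s where "th 1 = th 0 - q' 0 / (2 * v) * th 0 + ((q' s)\<^sup>2 / (4 * v\<^sup>2) - (k \<bullet> k) / v) * th s / 2"
    by (auto simp: diff_def numeral_2_eq_2)
  then have "\<bar>th 1 - th 0 + q' 0 / (2 * v) * th 0\<bar> \<le> 3 / v * (norm k)\<^sup>2 / 2"
    using bound[of s] by simp
  \<comment> \<open>The factor 1/2 of the Lagrange remainder is given away.\<close>
  also have "\<dots> \<le> 3 / v * (norm k)\<^sup>2"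
  proof -
    have "r / 2 \<le> r" if "0 \<le> r" for r :: real using that by simp
    then show ?thesis by this (use v in simp)
  qed
  finally have "c * \<bar>th 1 - th 0 + q' 0 / (2 * v) * th 0\<bar> \<le> c * (3 / v * (norm k)\<^sup>2)"
    by (rule mult_left_mono) (simp add: c_def)
  moreover have "c * \<bar>th 1 - th 0 + q' 0 / (2 * v) * th 0\<bar> =
     \<bar>c * th 1 - c * th 0 + c * th 0 / v * (w \<bullet> k)\<bar>"
  proof -
    have "c * \<bar>th 1 - th 0 + q' 0 / (2 * v) * th 0\<bar> = \<bar>c * (th 1 - th 0 + q' 0 / (2 * v) * th 0)\<bar>"
      by (simp add: abs_mult c_def)
    also have "c * (th 1 - th 0 + q' 0 / (2 * v) * th 0) = c * th 1 - c * th 0 + c * th 0 / v * (w \<bullet> k)"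
      using v by (simp add: q'_def field_simps)
    finally show ?thesis .
  qed
  moreover have "gauss m v (x + k) = c * th 1" "gauss m v x = c * th 0"
    unfolding gauss_def c_def th_def q w_def by (simp_all add: algebra_simps)
  moreover have "m - x = - w" by (simp add: w_def)
  moreover have "(2 * pi * v) powr (- real DIM('a) / 2) = c" by (simp add: c_def)
  ultimately show ?thesis
    by (simp add: mult_ac)
qed

lemma GDERIV_quadratic_bound:
  fixes f :: "'a::euclidean_space \<Rightarrow> real"
  assumes "\<And>k. \<bar>f (x + k) - f x - D \<bullet> k\<bar> \<le> B * (norm k)\<^sup>2"
  shows "GDERIV f x :> D"
  unfolding gderiv_def has_derivative_at
proof (intro conjI)
  show "bounded_linear (\<lambda>h. h \<bullet> D)" by (rule bounded_linear_inner_left)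
  show "((\<lambda>h. norm (f (x + h) - f x - h \<bullet> D) / norm h) \<longlongrightarrow> 0) (at 0)"
  proof (rule Lim_null_comparison)
    show "\<forall>\<^sub>F h in at 0. norm (norm (f (x + h) - f x - h \<bullet> D) / norm h) \<le> B * norm h"
    proof (rule eventually_mono[OF eventually_at_filter[THEN iffD2]])
      show "\<forall>\<^sub>F h in nhds 0. h \<noteq> (0::'a) \<longrightarrow> h \<in> UNIV \<longrightarrow> h \<noteq> 0" by simp
      show "norm (norm (f (x + h) - f x - h \<bullet> D) / norm h) \<le> B * norm h" if "h \<noteq> 0" for h
        using assms[of h] that
        by (simp add: divide_le_eq inner_commute power2_eq_square mult.assoc)
    qed
    show "((\<lambda>h. B * norm h) \<longlongrightarrow> 0) (at 0)"
      by (auto intro!: tendsto_eq_intros)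
  qed
qed

lemma grad_eqI: "GDERIV f x :> D \<Longrightarrow> grad f x = D"
  unfolding grad_def
proof (rule the_equality)
  fix E assume a: "GDERIV f x :> D" "GDERIV f x :> E"
  then have "(\<lambda>h. h \<bullet> D) = (\<lambda>h. h \<bullet> E)"
    unfolding gderiv_def by (rule has_derivative_unique)
  then show "E = D"
    by (metis vector_eq_ldot)
qed

section \<open>Densities of one component\<close>

lemma hvar_pos: "0 < t \<Longrightarrow> 0 < hvar t"
  by (simp add: hvar_def)

lemma htilde_pos: "0 < t \<Longrightarrow> 0 < htilde C t"
  using hvar_pos[of t] by (simp add: htilde_def add_nonneg_pos)

lemma borel_measurable_alpha [measurable]: "alpha \<in> borel_measurable borel"
  unfolding alpha_def by measurable

lemma borel_measurable_hvar [measurable]: "hvar \<in> borel_measurable borel"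
  unfolding hvar_def by measurable

lemma borel_measurable_htilde [measurable]: "htilde C \<in> borel_measurable borel"
  unfolding htilde_def by measurable

definition latent_law :: "('d::finite, 'n::finite) component \<Rightarrow> (real^'d) measure" where
  "latent_law C = density lborel (\<lambda>z. ennreal (latent_density C z))"

text \<open>One formula for three densities: \<open>B = loading C\<close> gives that of X_t,
  \<open>B = mat 1\<close> gives \<open>ld_density\<close>, and
  \<open>B = transpose U ** loading C\<close> gives that of the projection of X_t by
  \<open>transpose U\<close>.\<close>

definition smoothed :: "('d::finite, 'n::finite) component \<Rightarrow> real^'d^'m \<Rightarrow> real \<Rightarrow> real^'m \<Rightarrow> real" where
  "smoothed C B t x = (\<integral>z. gauss (alpha t *\<^sub>R (B *v z)) (htilde C t) x \<partial>latent_law C)"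

text \<open>The gradient taken under the integral sign. Being an explicit integral, it is jointly
  measurable in time and space.\<close>

definition ld_gradient :: "('d::finite, 'n::finite) component \<Rightarrow> real \<Rightarrow> real^'d \<Rightarrow> real^'d" where
  "ld_gradient C t y =
    (\<integral>z. (gauss (alpha t *\<^sub>R z) (htilde C t) y / htilde C t) *\<^sub>R (alpha t *\<^sub>R z - y) \<partial>latent_law C)"

lemma sets_latent_law [measurable_cong, simp]: "sets (latent_law C) = sets borel"
  by (simp add: latent_law_def)

lemma space_latent_law [simp]: "space (latent_law C) = UNIV"
  by (simp add: latent_law_def)

locale latent_model =
  fixes C :: "('d::finite, 'n::finite) component"
  assumes loading: "orthonormal_cols (loading C)" and noise_sd_pos: "0 < noise_sd C"
    and prob_latent: "prob_space (latent_law C)"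
    and latent_density_measurable [measurable]: "latent_density C \<in> borel_measurable borel"
    and latent_density_nonneg: "\<And>z. 0 \<le> latent_density C z"
begin

sublocale latent: prob_space "latent_law C"
  by (rule prob_latent)

lemma integrable_gauss:
  fixes B :: "real^'d^'m" and x :: "real^'m"
  assumes "0 < v"
  shows "integrable (latent_law C) (\<lambda>z. gauss (a *\<^sub>R (B *v z)) v x)"
  by (rule latent.integrable_const_bound[where B="(2 * pi * v) powr (- real (DIM(real^'m)) / 2)"])
    (simp_all add: gauss_le[OF assms, where 'a="real^'m", simplified])

lemma borel_measurable_smoothed [measurable]:
  "(\<lambda>p. smoothed C B (f p) (g p)) \<in> borel_measurable N"
  if [measurable]: "f \<in> borel_measurable N" "g \<in> borel_measurable N"
  unfolding smoothed_def by measurable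

lemma borel_measurable_ld_gradient [measurable]:
  "(\<lambda>p. ld_gradient C (f p) (g p)) \<in> borel_measurable N"
  if [measurable]: "f \<in> borel_measurable N" "g \<in> borel_measurable N"
  unfolding ld_gradient_def by measurable

lemma ennreal_smoothed:
  "0 < t \<Longrightarrow> ennreal (smoothed C B t x) =
    (\<integral>\<^sup>+z. ennreal (gauss (alpha t *\<^sub>R (B *v z)) (htilde C t) x) \<partial>latent_law C)"
  unfolding smoothed_def
  by (subst nn_integral_eq_integral) (auto intro!: integrable_gauss htilde_pos)

lemma smoothed_pos:
  assumes t: "0 < t"
  shows "0 < smoothed C B t x"
proof -
  have "smoothed C B t x \<noteq> 0"
  proof
    assume "smoothed C B t x = 0"
    then have "AE z in latent_law C. gauss (alpha t *\<^sub>R (B *v z)) (htilde C t) x = 0"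
      unfolding smoothed_def
      using integral_nonneg_eq_0_iff_AE[OF integrable_gauss[OF htilde_pos[OF t]]] by auto
    moreover have "gauss (alpha t *\<^sub>R (B *v z)) (htilde C t) x \<noteq> 0" for z
      using gauss_pos[OF htilde_pos[OF t]] by (metis less_irrefl)
    ultimately have "AE z in latent_law C. False"
      by simp
    then show False by simp
  qed
  moreover have "0 \<le> smoothed C B t x"
    unfolding smoothed_def by (rule Bochner_Integration.integral_nonneg) simp
  ultimately show ?thesis by simp
qed

lemma ld_density_eq: "ld_density C t y = smoothed C (mat 1) t y"
  unfolding ld_density_def smoothed_def latent_law_def
  by (subst integral_density) (auto simp: latent_density_nonneg mult.commute)

text \<open>Integrating \<open>gauss_taylor_bound\<close> over a probability law keeps the remainder
  quadratic in \<open>k\<close>, and a quadratic remainder identifies the gradient.\<close>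

lemma GDERIV_ld_density:
  assumes t: "0 < t"
  shows "GDERIV (ld_density C t) y :> ld_gradient C t y"
proof (rule GDERIV_quadratic_bound)
  fix k
  define v where "v = htilde C t"
  have v: "0 < v" unfolding v_def by (rule htilde_pos[OF t])
  define c where "c = (2 * pi * v) powr (- real DIM(real^'d) / 2)"
  let ?g = "\<lambda>z y. gauss (alpha t *\<^sub>R z) v y"
  let ?G = "\<lambda>z. (?g z y / v) *\<^sub>R (alpha t *\<^sub>R z - y)"
  have ig: "integrable (latent_law C) (\<lambda>z. ?g z y)" for y
    using integrable_gauss[OF v, of "alpha t" "mat 1" y] by simp
  have iG: "integrable (latent_law C) ?G"
  proof (rule latent.integrable_const_bound[where B="(c + 2 * v * c) / v"])
    show "AE z in latent_law C. norm (?G z) \<le> (c + 2 * v * c) / v"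
    proof (rule AE_I2)
      fix z
      have "norm (alpha t *\<^sub>R z - y) \<le> 1 + (norm (y - alpha t *\<^sub>R z))\<^sup>2"
      proof -
        \<comment> \<open>Trades the norm for its square, so that the two uniform bounds on
          \<open>gauss\<close> and on its product with the squared norm apply.\<close>
        have "a \<le> 1 + a\<^sup>2" for a :: real
          using zero_le_power2[of "a - 1/2"] by (simp add: power2_eq_square algebra_simps)
        then show ?thesis by (metis norm_minus_commute)
      qed
      then have "?g z y * norm (alpha t *\<^sub>R z - y) \<le> ?g z y * (1 + (norm (y - alpha t *\<^sub>R z))\<^sup>2)"
        by (rule mult_left_mono) simp
      also have "\<dots> \<le> c + 2 * v * c"
        using norm_sq_mult_gauss_le[OF v, of y "alpha t *\<^sub>R z"] gauss_le[OF v, of "alpha t *\<^sub>R z" y]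
        by (simp add: distrib_left c_def mult_ac)
      finally show "norm (?G z) \<le> (c + 2 * v * c) / v"
        using v by (simp add: divide_right_mono)
    qed
  qed measurable
  have "(\<integral>z. ?g z (y + k) - ?g z y - ?G z \<bullet> k \<partial>latent_law C) =
     (\<integral>z. ?g z (y + k) - ?g z y \<partial>latent_law C) - (\<integral>z. ?G z \<bullet> k \<partial>latent_law C)"
    by (rule Bochner_Integration.integral_diff
        [OF Bochner_Integration.integrable_diff[OF ig ig] integrable_inner_left[OF iG]])
  also have "(\<integral>z. ?g z (y + k) - ?g z y \<partial>latent_law C) = ld_density C t (y + k) - ld_density C t y"
    unfolding ld_density_eq smoothed_def v_def[symmetric]
    by (simp add: Bochner_Integration.integral_diff[OF ig ig])
  also have "(\<integral>z. ?G z \<bullet> k \<partial>latent_law C) = ld_gradient C t y \<bullet> k"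
    unfolding ld_gradient_def v_def[symmetric]
    by (rule integral_inner_left[OF iG])
  finally have "\<bar>ld_density C t (y + k) - ld_density C t y - ld_gradient C t y \<bullet> k\<bar> =
     \<bar>\<integral>z. ?g z (y + k) - ?g z y - ?G z \<bullet> k \<partial>latent_law C\<bar>"
    by simp
  also have "\<dots> \<le> (\<integral>z. \<bar>?g z (y + k) - ?g z y - ?G z \<bullet> k\<bar> \<partial>latent_law C)"
    by (rule integral_abs_bound)
  also have "\<dots> \<le> (\<integral>z. 3 * c / v * (norm k)\<^sup>2 \<partial>latent_law C)"
  proof (rule integral_mono)
    show "integrable (latent_law C) (\<lambda>z. \<bar>?g z (y + k) - ?g z y - ?G z \<bullet> k\<bar>)"
      using ig iG by (intro integrable_abs Bochner_Integration.integrable_diff integrable_inner_left)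
  qed (use gauss_taylor_bound[OF v, where 'a="real^'d"] in \<open>auto simp: c_def\<close>)
  also have "\<dots> = 3 * c / v * (norm k)\<^sup>2"
    by (simp add: latent.prob_space[unfolded space_latent_law])
  finally show "\<bar>ld_density C t (y + k) - ld_density C t y - ld_gradient C t y \<bullet> k\<bar> \<le> 3 * c / v * (norm k)\<^sup>2" .
qed

end

section \<open>Factorisation of a component's density, its score, and the laws of X_t and of its
  projections\<close>

context latent_model
begin

text \<open>The centres \<open>alpha t *\<^sub>R (B *v z)\<close> lie in the column space of
  \<open>B\<close>, so the orthogonal Gaussian factor does not depend on \<open>z\<close> and leaves
  the integral.\<close>

lemma smoothed_split:
  fixes B :: "real^'d^'m"
  assumes B: "orthonormal_cols B" and t: "0 < t"
  shows "smoothed C B t x =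
      (2 * pi * htilde C t) powr (- (real CARD('m) - real CARD('d)) / 2) *
      exp (- (norm (x - B *v (transpose B *v x)))\<^sup>2 / (2 * htilde C t)) *
      ld_density C t (transpose B *v x)"
proof -
  define c where "c = (2 * pi * htilde C t) powr (- (real CARD('m) - real CARD('d)) / 2) *
      exp (- (norm (x - B *v (transpose B *v x)))\<^sup>2 / (2 * htilde C t))"
  have "gauss (alpha t *\<^sub>R (B *v z)) (htilde C t) x =
     c * gauss (alpha t *\<^sub>R z) (htilde C t) (transpose B *v x)" for z
    by (subst gauss_orthonormal_split[OF B htilde_pos[OF t]])
      (simp add: c_def matrix_vector_mult_diff_distrib matrix_vector_mult_scaleR
        transpose_mult_orthonormal[OF B])
  then show ?thesis
    unfolding smoothed_def ld_density_eq c_def[symmetric] by simp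
qed

lemma ld_density_pos: "0 < t \<Longrightarrow> 0 < ld_density C t y"
  by (simp add: ld_density_eq smoothed_pos)

lemma ld_score_eq:
  assumes "0 < t"
  shows "ld_score C t y = (1 / ld_density C t y) *\<^sub>R ld_gradient C t y"
  unfolding ld_score_def
  by (rule grad_eqI, rule GDERIV_DERIV_compose[OF GDERIV_ld_density[OF assms]])
    (use ld_density_pos[OF assms, of y] in \<open>auto intro!: derivative_eq_intros\<close>)

text \<open>Product rule for \<open>smoothed_split\<close>: the latent factor contributes its score
  mapped by \<open>B\<close>, the orthogonal Gaussian factor the score of a centred
  Gaussian.\<close>

lemma GDERIV_smoothed:
  fixes B :: "real^'d^'m"
  assumes B: "orthonormal_cols B" and t: "0 < t"
  shows "GDERIV (smoothed C B t) x :> smoothed C B t x *\<^sub>R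
    (B *v ld_score C t (transpose B *v x) - (1 / htilde C t) *\<^sub>R (x - B *v (transpose B *v x)))"
proof -
  define P where "P x = x - B *v (transpose B *v x)" for x
  define v where "v = htilde C t"
  have v: "0 < v" unfolding v_def by (rule htilde_pos[OF t])
  have linP: "bounded_linear P"
    unfolding P_def
    by (intro bounded_linear_sub bounded_linear_ident bounded_linear_compose[OF matrix_vector_mul_bounded_linear]
        matrix_vector_mul_bounded_linear)
  \<comment> \<open>\<open>P\<close> is a symmetric idempotent, which gives the squared norm of
    \<open>P x\<close> the gradient \<open>2 *\<^sub>R P x\<close>.\<close>
  have P_sym: "P k \<bullet> P x = k \<bullet> P x" for k
    by (simp add: P_def inner_diff inner_mult_transpose matrix_vector_mult_diff_distrib
        transpose_mult_orthonormal[OF B])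
  have dP: "(P has_derivative P) (at x)"
    by (rule bounded_linear_imp_has_derivative[OF linP])
  have 1: "GDERIV (\<lambda>x. P x \<bullet> P x) x :> 2 *\<^sub>R P x"
    unfolding gderiv_def
    by (rule has_derivative_eq_rhs[OF has_derivative_inner[OF dP dP]])
      (simp add: fun_eq_iff P_sym inner_commute[of "P x"])
  have "GDERIV (\<lambda>x. exp (- (P x \<bullet> P x) / (2 * v))) x :> (- exp (- (P x \<bullet> P x) / (2 * v)) / (2 * v)) *\<^sub>R (2 *\<^sub>R P x)"
    by (rule GDERIV_DERIV_compose[OF 1]) (use v in \<open>auto intro!: derivative_eq_intros\<close>)
  then have 2: "GDERIV (\<lambda>x. exp (- (P x \<bullet> P x) / (2 * v))) x :> (- exp (- (P x \<bullet> P x) / (2 * v)) / v) *\<^sub>R P x"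
    using v by simp
  have 3: "GDERIV (\<lambda>x. ld_density C t (transpose B *v x)) x :> B *v ld_gradient C t (transpose B *v x)"
    unfolding gderiv_def
    by (rule has_derivative_eq_rhs[OF has_derivative_compose[OF
          bounded_linear_imp_has_derivative[OF matrix_vector_mul_bounded_linear]
          GDERIV_ld_density[OF t, unfolded gderiv_def]]])
      (simp add: inner_transpose_mult)
  define c where "c = (2 * pi * v) powr (- (real CARD('m) - real CARD('d)) / 2)"
  have s: "smoothed C B t = (\<lambda>x. c * (exp (- (P x \<bullet> P x) / (2 * v)) * ld_density C t (transpose B *v x)))"
    by (simp add: fun_eq_iff smoothed_split[OF B t] c_def v_def P_def power2_norm_eq_inner)
  have "GDERIV (smoothed C B t) x :>
     c *\<^sub>R (exp (- (P x \<bullet> P x) / (2 * v)) *\<^sub>R (B *v ld_gradient C t (transpose B *v x)) +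
       ld_density C t (transpose B *v x) *\<^sub>R ((- exp (- (P x \<bullet> P x) / (2 * v)) / v) *\<^sub>R P x))"
    unfolding s
    by (rule GDERIV_DERIV_compose[OF GDERIV_mult[OF 2 3]]) (auto intro!: derivative_eq_intros)
  also have "c *\<^sub>R (exp (- (P x \<bullet> P x) / (2 * v)) *\<^sub>R (B *v ld_gradient C t (transpose B *v x)) +
       ld_density C t (transpose B *v x) *\<^sub>R ((- exp (- (P x \<bullet> P x) / (2 * v)) / v) *\<^sub>R P x)) =
     smoothed C B t x *\<^sub>R (B *v ld_score C t (transpose B *v x) - (1 / v) *\<^sub>R P x)"
    using ld_density_pos[OF t, of "transpose B *v x"]
    by (simp add: s ld_score_eq[OF t] matrix_vector_mult_scaleR scaleR_diff_right scaleR_add_right)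
  finally show ?thesis by (simp add: P_def v_def)
qed

text \<open>Given \<open>z\<close>, the data noise scaled by \<open>alpha t\<close> and the forward
  noise are independent Gaussians whose variances add up to \<open>htilde C t\<close>.
  \<open>gauss_product\<close> exhibits this sum and leaves a Gaussian in \<open>e\<close> that
  integrates to 1.\<close>

lemma fwd_density_eq:
  assumes t: "0 < t"
  shows "fwd_density C t x = smoothed C (loading C) t x"
proof -
  define N where "N = density lborel (\<lambda>e. ennreal (gauss 0 ((noise_sd C)\<^sup>2) (e :: real^'n)))"
  define V where "V = htilde C t"
  have V: "V = (alpha t)\<^sup>2 * (noise_sd C)\<^sup>2 + hvar t" by (simp add: V_def htilde_def)
  have Vp: "0 < V" unfolding V_def by (rule htilde_pos[OF t])
  have setsN [measurable_cong]: "sets N = sets borel" by (simp add: N_def)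
  interpret N: prob_space N
    by (rule prob_spaceI) (simp add: N_def emeasure_density nn_integral_gauss[OF zero_less_power[OF noise_sd_pos]])
  let ?f = "\<lambda>x0. gauss (alpha t *\<^sub>R x0) (hvar t) x"
  have dl: "data_law C = distr (latent_law C \<Otimes>\<^sub>M N) borel (\<lambda>(z, e). loading C *v z + e)"
    by (simp add: data_law_def latent_law_def N_def)
  have "ennreal (smoothed C (loading C) t x) = (\<integral>\<^sup>+z. (\<integral>\<^sup>+e. ennreal (?f (loading C *v z + e)) \<partial>N) \<partial>latent_law C)"
    unfolding ennreal_smoothed[OF t]
  proof (rule nn_integral_cong)
    fix z
    let ?m = "loading C *v z"
    have "(\<integral>\<^sup>+e. ennreal (?f (?m + e)) \<partial>N) =
      (\<integral>\<^sup>+e. ennreal (?f (?m + e) * gauss 0 ((noise_sd C)\<^sup>2) e) \<partial>lborel)"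
      by (simp add: N_def nn_integral_density ennreal_mult mult.commute)
    also have "\<dots> = (\<integral>\<^sup>+e. ennreal (gauss (alpha t *\<^sub>R ?m) V x) * ennreal (gauss
        ((alpha t * (noise_sd C)\<^sup>2 / V) *\<^sub>R (x - alpha t *\<^sub>R ?m)) (hvar t * (noise_sd C)\<^sup>2 / V) e) \<partial>lborel)"
      using noise_sd_pos by (simp add: gauss_product[OF hvar_pos[OF t] _ V] ennreal_mult)
    also have "\<dots> = ennreal (gauss (alpha t *\<^sub>R ?m) V x)"
      using Vp hvar_pos[OF t] noise_sd_pos
      by (subst nn_integral_cmult) (simp_all add: nn_integral_gauss)
    finally show "ennreal (gauss (alpha t *\<^sub>R ?m) (htilde C t) x) = (\<integral>\<^sup>+e. ennreal (?f (?m + e)) \<partial>N)"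
      by (simp add: V_def)
  qed
  also have "\<dots> = (\<integral>\<^sup>+p. ennreal (?f (case p of (z, e) \<Rightarrow> loading C *v z + e)) \<partial>(latent_law C \<Otimes>\<^sub>M N))"
    by (subst N.nn_integral_fst[symmetric]) simp_all
  also have "\<dots> = (\<integral>\<^sup>+x0. ennreal (?f x0) \<partial>data_law C)"
    unfolding dl by (subst nn_integral_distr) auto
  \<comment> \<open>For a nonnegative measurable integrand the Bochner integral is
    \<open>enn2real\<close> of the nonnegative one, so no integrability check against
    \<open>data_law C\<close> arises.\<close>
  finally have "enn2real (ennreal (smoothed C (loading C) t x)) = enn2real (\<integral>\<^sup>+x0. ennreal (?f x0) \<partial>data_law C)"
    by simp
  also have "\<dots> = fwd_density C t x"
    unfolding fwd_density_def by (rule integral_eq_nn_integral[symmetric]) (auto simp: data_law_def)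
  finally show ?thesis
    using smoothed_pos[OF t, of "loading C" x] by simp
qed

lemma nn_integral_smoothed:
  fixes B :: "real^'d^'m" and F :: "real^'m \<Rightarrow> ennreal"
  assumes t: "0 < t" and [measurable]: "F \<in> borel_measurable borel"
  shows "(\<integral>\<^sup>+x. F x * ennreal (smoothed C B t x) \<partial>lborel) =
    (\<integral>\<^sup>+z. (\<integral>\<^sup>+x. F x * ennreal (gauss (alpha t *\<^sub>R (B *v z)) (htilde C t) x) \<partial>lborel) \<partial>latent_law C)"
proof -
  interpret pair_sigma_finite "latent_law C" "lborel :: (real^'m) measure" ..
  have "(\<integral>\<^sup>+x. F x * ennreal (smoothed C B t x) \<partial>lborel) =
    (\<integral>\<^sup>+x. (\<integral>\<^sup>+z. F x * ennreal (gauss (alpha t *\<^sub>R (B *v z)) (htilde C t) x) \<partial>latent_law C) \<partial>lborel)"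
    by (simp add: ennreal_smoothed[OF t] nn_integral_cmult)
  also have "\<dots> = (\<integral>\<^sup>+z. (\<integral>\<^sup>+x. F x * ennreal (gauss (alpha t *\<^sub>R (B *v z)) (htilde C t) x) \<partial>lborel) \<partial>latent_law C)"
    by (rule Fubini') measurable
  finally show ?thesis .
qed

lemma fwd_law_eq: "0 < t \<Longrightarrow> fwd_law C t = density lborel (\<lambda>x. ennreal (smoothed C (loading C) t x))"
  by (simp add: fwd_law_def fwd_density_eq)

text \<open>Given \<open>z\<close>, orthonormal columns project an isotropic Gaussian to one of the
  same variance; projecting therefore only replaces the loading by
  \<open>transpose U ** loading C\<close>.\<close>

lemma distr_fwd_law:
  fixes U :: "real^'m^'n"
  assumes U: "orthonormal_cols U" and t: "0 < t"
  shows "distr (fwd_law C t) borel (\<lambda>x. transpose U *v x) =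
    density lborel (\<lambda>z. ennreal (smoothed C (transpose U ** loading C) t z))"
proof (rule measure_eqI)
  fix S assume "S \<in> sets (distr (fwd_law C t) borel (\<lambda>x. transpose U *v x))"
  then have [measurable]: "S \<in> sets borel" by simp
  have "emeasure (distr (fwd_law C t) borel (\<lambda>x. transpose U *v x)) S =
     (\<integral>\<^sup>+z. indicator S z \<partial>distr (fwd_law C t) borel (\<lambda>x. transpose U *v x))"
    by simp
  also have "\<dots> = (\<integral>\<^sup>+x. indicator S (transpose U *v x) \<partial>fwd_law C t)"
    by (rule nn_integral_distr) (simp_all add: fwd_law_def)
  also have "\<dots> = (\<integral>\<^sup>+x. indicator S (transpose U *v x) * ennreal (smoothed C (loading C) t x) \<partial>lborel)"
    unfolding fwd_law_eq[OF t] by (subst nn_integral_density) (simp_all add: mult.commute)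
  also have "\<dots> = (\<integral>\<^sup>+z. (\<integral>\<^sup>+x. indicator S (transpose U *v x) *
      ennreal (gauss (alpha t *\<^sub>R (loading C *v z)) (htilde C t) x) \<partial>lborel) \<partial>latent_law C)"
    by (rule nn_integral_smoothed[OF t]) measurable
  also have "\<dots> = (\<integral>\<^sup>+z. (\<integral>\<^sup>+w. indicator S w *
      ennreal (gauss (alpha t *\<^sub>R ((transpose U ** loading C) *v z)) (htilde C t) w) \<partial>lborel) \<partial>latent_law C)"
    by (simp add: nn_integral_gauss_proj[OF U htilde_pos[OF t]] matrix_vector_mult_scaleR matrix_vector_mul_assoc)
  also have "\<dots> = (\<integral>\<^sup>+w. indicator S w * ennreal (smoothed C (transpose U ** loading C) t w) \<partial>lborel)"
    by (rule nn_integral_smoothed[OF t, symmetric]) measurable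
  also have "\<dots> = emeasure (density lborel (\<lambda>z. ennreal (smoothed C (transpose U ** loading C) t z))) S"
    by (simp add: emeasure_density mult.commute)
  finally show "emeasure (distr (fwd_law C t) borel (\<lambda>x. transpose U *v x)) S =
    emeasure (density lborel (\<lambda>z. ennreal (smoothed C (transpose U ** loading C) t z))) S" .
qed simp

lemma AE_proj_density:
  fixes U :: "real^'m^'n"
  assumes U: "orthonormal_cols U" and t: "0 < t"
  shows "AE z in lborel. proj_density C U t z = smoothed C (transpose U ** loading C) t z"
proof -
  have "AE z in lborel. ennreal (smoothed C (transpose U ** loading C) t z) =
      RN_deriv lborel (distr (fwd_law C t) borel (\<lambda>x. transpose U *v x)) z"
    by (rule sigma_finite_measure.RN_deriv_unique[OF sigma_finite_lborel]) (simp_all add: distr_fwd_law[OF U t])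
  then show ?thesis
    unfolding proj_density_def
    by eventually_elim (metis enn2real_ennreal less_imp_le smoothed_pos t)
qed

text \<open>Given \<open>z\<close>, the mean is fixed by the projection and drops out of the
  residual, so the inner integral is the same for all \<open>z\<close> and the latent law only
  contributes its mass 1. The next lemma uses the same cancellation.\<close>

lemma nn_integral_fwd_perp_norm_sq:
  fixes W :: "real^'k^'n"
  assumes W: "orthonormal_cols W" and WA: "\<And>z. W *v (transpose W *v (loading C *v z)) = loading C *v z"
    and t: "0 < t"
  shows "(\<integral>\<^sup>+x. ennreal ((norm (x - W *v (transpose W *v x)))\<^sup>2) * ennreal (smoothed C (loading C) t x) \<partial>lborel) =
    ennreal (htilde C t * (real CARD('n) - real CARD('k)))"
proof -
  have "(\<integral>\<^sup>+x. ennreal ((norm (x - W *v (transpose W *v x)))\<^sup>2) *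
      ennreal (gauss (alpha t *\<^sub>R (loading C *v z)) (htilde C t) x) \<partial>lborel) =
    ennreal (htilde C t * (real CARD('n) - real CARD('k)))" for z
    using nn_integral_gauss_perp_norm_sq[OF W htilde_pos[OF t], of "alpha t *\<^sub>R (loading C *v z)"]
    by (simp add: matrix_vector_mult_diff_distrib matrix_vector_mult_scaleR WA)
  then show ?thesis
    by (subst nn_integral_smoothed[OF t]) (simp_all add: latent.emeasure_space_1[unfolded space_latent_law])
qed

lemma nn_integral_fwd_nested_norm_sq:
  fixes W :: "real^'k^'n"
  assumes W: "orthonormal_cols W" and WA: "\<And>z. W *v (transpose W *v (loading C *v z)) = loading C *v z"
    and t: "0 < t"
  shows "(\<integral>\<^sup>+x. ennreal ((norm (W *v (transpose W *v x) - loading C *v (transpose (loading C) *v x)))\<^sup>2) *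
      ennreal (smoothed C (loading C) t x) \<partial>lborel) =
    ennreal (htilde C t * (real CARD('k) - real CARD('d)))"
proof -
  have "(\<integral>\<^sup>+x. ennreal ((norm (W *v (transpose W *v x) - loading C *v (transpose (loading C) *v x)))\<^sup>2) *
      ennreal (gauss (alpha t *\<^sub>R (loading C *v z)) (htilde C t) x) \<partial>lborel) =
    ennreal (htilde C t * (real CARD('k) - real CARD('d)))" for z
    using nn_integral_gauss_nested_norm_sq[OF W loading WA htilde_pos[OF t], of "alpha t *\<^sub>R (loading C *v z)"]
    by (simp add: matrix_vector_mult_diff_distrib matrix_vector_mult_scaleR WA transpose_mult_orthonormal[OF loading])
  then show ?thesis
    by (subst nn_integral_smoothed[OF t]) (simp_all add: latent.emeasure_space_1[unfolded space_latent_law])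
qed

end

section \<open>Linear algebra of the score error\<close>

text \<open>\<open>pinv\<close> is a definite description, so uniqueness has to be proved as well: a
  left inverse \<open>transpose H\<close> forces \<open>X ** H = mat 1\<close>, and symmetry of
  \<open>H ** X\<close> then determines \<open>X\<close>.\<close>

lemma pinv_orthonormal:
  assumes H: "orthonormal_cols H"
  shows "pinv H = transpose H"
  unfolding pinv_def
proof (rule the_equality)
  have HH: "transpose H ** H = mat 1" using H by (simp add: orthonormal_cols_def)
  show "H ** transpose H ** H = H \<and> transpose H ** H ** transpose H = transpose H \<and>
    transpose (H ** transpose H) = H ** transpose H \<and> transpose (transpose H ** H) = transpose H ** H"
    by (simp add: HH matrix_mul_assoc[symmetric] matrix_transpose_mul)
  fix X assume X: "H ** X ** H = H \<and> X ** H ** X = X \<and>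
    transpose (H ** X) = H ** X \<and> transpose (X ** H) = X ** H"
  have "X ** H = transpose H ** (H ** X ** H)"
    by (simp add: matrix_mul_assoc HH)
  also have "\<dots> = mat 1" using X HH by simp
  finally have XH: "X ** H = mat 1" .
  have "X = transpose H ** (H ** X)"
    by (simp add: matrix_mul_assoc HH)
  also have "H ** X = transpose X ** transpose H"
    using X by (metis matrix_transpose_mul)
  also have "transpose H ** (transpose X ** transpose H) = transpose (X ** H) ** transpose H"
    by (simp add: matrix_transpose_mul matrix_mul_assoc)
  also have "\<dots> = transpose H"
    by (simp add: XH transpose_mat)
  finally show "X = transpose H" .
qed

lemma proj_fixes_span_columns:
  fixes W :: "real^'k^'n"
  assumes W: "orthonormal_cols W" and "y \<in> span (columns W)"
  shows "W *v (transpose W *v y) = y"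
  using assms(2)
proof (induction rule: span_induct)
  case base
  show ?case
    by (auto simp: subspace_def matrix_vector_right_distrib matrix_vector_mult_scaleR)
next
  case (step y)
  then obtain i where "y = W *v axis i 1"
    by (auto simp: columns_def matrix_vector_mult_basis)
  then show ?case by (simp add: transpose_mult_orthonormal[OF W])
qed

lemma perp_proj_mult_eq_0:
  fixes W :: "real^'k^'n" and A :: "real^'d^'n"
  assumes "\<And>z. W *v (transpose W *v (A *v z)) = A *v z"
  shows "perp_proj W ** A = 0"
  unfolding matrix_eq
  using assms
  by (simp add: perp_proj_def matrix_vector_mul_assoc[symmetric] matrix_vector_mult_diff_rdistrib)

lemma convex_norm_sq_le:
  fixes u v :: "'a::real_inner"
  assumes "0 \<le> a" "0 \<le> b" "a + b = 1"
  shows "(norm (a *\<^sub>R u + b *\<^sub>R v))\<^sup>2 \<le> a * (norm u)\<^sup>2 + b * (norm v)\<^sup>2"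
proof -
  have "a * (norm u)\<^sup>2 + b * (norm v)\<^sup>2 - (norm (a *\<^sub>R u + b *\<^sub>R v))\<^sup>2 = a * b * (norm (u - v))\<^sup>2"
  proof -
    have b: "b = 1 - a" using assms by simp
    show ?thesis
      unfolding power2_norm_eq_inner b
      by (simp add: inner_add inner_diff inner_commute algebra_simps)
  qed
  moreover have "0 \<le> a * b * (norm (u - v))\<^sup>2" using assms by simp
  ultimately show ?thesis by linarith
qed

lemma norm_add_sq_le_Young:
  fixes u v :: "'a::real_inner"
  assumes "0 < \<eta>"
  shows "(norm (u + v))\<^sup>2 \<le> (1 + 1 / \<eta>) * (norm u)\<^sup>2 + (1 + \<eta>) * (norm v)\<^sup>2"
proof -
  have "(norm ((1 / sqrt \<eta>) *\<^sub>R u - sqrt \<eta> *\<^sub>R v))\<^sup>2 = (norm u)\<^sup>2 / \<eta> + \<eta> * (norm v)\<^sup>2 - 2 * (u \<bullet> v)"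
    using assms unfolding power2_norm_eq_inner
    by (simp add: inner_diff inner_commute algebra_simps)
  moreover have "(norm (u + v))\<^sup>2 = (norm u)\<^sup>2 + (norm v)\<^sup>2 + 2 * (u \<bullet> v)"
    unfolding power2_norm_eq_inner by (simp add: inner_add inner_commute)
  moreover have "0 \<le> (norm ((1 / sqrt \<eta>) *\<^sub>R u - sqrt \<eta> *\<^sub>R v))\<^sup>2" by simp
  ultimately show ?thesis by (simp add: distrib_right)
qed

lemma norm_diff_sq_le: "(norm (u - v))\<^sup>2 \<le> 2 * (norm u)\<^sup>2 + 2 * (norm v)\<^sup>2"
  for u v :: "'a::real_inner"
  using norm_add_sq_le_Young[of 1 u "- v"] by simp

text \<open>Roles: \<open>a\<close> is network minus comparator, \<open>e\<close> the posterior
  mismatch, \<open>d\<close> the difference of the two \<open>psi\<close>, \<open>p1\<close> and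
  \<open>p2\<close> the posteriors, \<open>r1\<close> and \<open>r2\<close> the noise ratios,
  \<open>n1\<close> and \<open>n2\<close> the noise inside the column space of \<open>W\<close>, and
  \<open>y\<close> the noise orthogonal to it.\<close>

lemma score_error_bound:
  fixes W :: "real^'k^'n"
  assumes W: "orthonormal_cols W" and \<eta>: "0 < \<eta>"
    and p: "0 \<le> p1" "0 \<le> p2" "p1 + p2 = 1"
    and n: "W *v (transpose W *v n1) = n1" "W *v (transpose W *v n2) = n2"
    and y: "transpose W *v y = 0"
  shows "(norm (W *v (a + e *\<^sub>R d) - (p1 *\<^sub>R (r1 *\<^sub>R n1) + p2 *\<^sub>R (r2 *\<^sub>R n2)) -
        (p1 *\<^sub>R (r1 *\<^sub>R y) + p2 *\<^sub>R (r2 *\<^sub>R y))))\<^sup>2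
    \<le> (1 + 1 / \<eta>) * (norm a)\<^sup>2 + (1 + \<eta>) * (2 * (e\<^sup>2 * (norm d)\<^sup>2) +
        (2 * (p1 * (r1\<^sup>2 * (norm n1)\<^sup>2) + p2 * (r2\<^sup>2 * (norm n2)\<^sup>2)) +
         (p1 * (r1\<^sup>2 * (norm y)\<^sup>2) + p2 * (r2\<^sup>2 * (norm y)\<^sup>2))))"
proof -
  define n where "n = p1 *\<^sub>R (r1 *\<^sub>R n1) + p2 *\<^sub>R (r2 *\<^sub>R n2)"
  define Y where "Y = p1 *\<^sub>R (r1 *\<^sub>R y) + p2 *\<^sub>R (r2 *\<^sub>R y)"
  \<comment> \<open>Pulls the inner noise back to coordinates, so that everything but
    \<open>Y\<close> is \<open>W\<close> applied to one vector and keeps its norm.\<close>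
  define u where "u = transpose W *v n"
  have Wu: "W *v u = n"
    by (simp add: u_def n_def matrix_vector_right_distrib matrix_vector_mult_scaleR n)
  have WY: "transpose W *v Y = 0"
    by (simp add: Y_def matrix_vector_right_distrib matrix_vector_mult_scaleR y)
  have nu: "norm u = norm n"
    using norm_orthonormal_mult[OF W, of u] by (simp add: Wu)
  have "(norm (W *v (a + e *\<^sub>R d) - n - Y))\<^sup>2 = (norm (W *v (a + (e *\<^sub>R d - u)) + (- Y)))\<^sup>2"
    by (simp add: Wu[symmetric] matrix_vector_right_distrib matrix_vector_mult_diff_distrib algebra_simps)
  also have "\<dots> = (norm (W *v (a + (e *\<^sub>R d - u))))\<^sup>2 + (norm (- Y))\<^sup>2"
    by (rule norm_add_Pythagorean) (simp add: orthogonal_def inner_mult_transpose WY)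
  also have "\<dots> = (norm (a + (e *\<^sub>R d - u)))\<^sup>2 + (norm Y)\<^sup>2"
    by (simp add: norm_orthonormal_mult[OF W])
  \<comment> \<open>Young's inequality acts on the coordinate part only; the coefficient of the
    \<open>Y\<close> term is raised from 1 to \<open>1 + \<eta>\<close> merely to share a
    factor.\<close>
  also have "\<dots> \<le> ((1 + 1 / \<eta>) * (norm a)\<^sup>2 + (1 + \<eta>) * (norm (e *\<^sub>R d - u))\<^sup>2) + (1 + \<eta>) * (norm Y)\<^sup>2"
    using norm_add_sq_le_Young[OF \<eta>, of a "e *\<^sub>R d - u"] \<eta>
    by (intro add_mono) (auto simp: mult_le_cancel_right1)
  also have "\<dots> = (1 + 1 / \<eta>) * (norm a)\<^sup>2 + (1 + \<eta>) * ((norm (e *\<^sub>R d - u))\<^sup>2 + (norm Y)\<^sup>2)"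
    by (simp add: distrib_left)
  also have "\<dots> \<le> (1 + 1 / \<eta>) * (norm a)\<^sup>2 + (1 + \<eta>) * (2 * (e\<^sup>2 * (norm d)\<^sup>2) +
        (2 * (p1 * (r1\<^sup>2 * (norm n1)\<^sup>2) + p2 * (r2\<^sup>2 * (norm n2)\<^sup>2)) +
         (p1 * (r1\<^sup>2 * (norm y)\<^sup>2) + p2 * (r2\<^sup>2 * (norm y)\<^sup>2))))"
  proof (intro add_left_mono mult_left_mono)
    have sum: "X + Z \<le> 2 * E + (2 * Q + R)" if "X \<le> 2 * E + 2 * N" "N \<le> Q" "Z \<le> R"
      for X Z E Q R N :: real using that by linarith
    have "(norm (e *\<^sub>R d - u))\<^sup>2 \<le> 2 * (e\<^sup>2 * (norm d)\<^sup>2) + 2 * (norm n)\<^sup>2"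
      using norm_diff_sq_le[of "e *\<^sub>R d" u] by (simp add: nu power_mult_distrib)
    moreover have "(norm n)\<^sup>2 \<le> p1 * (r1\<^sup>2 * (norm n1)\<^sup>2) + p2 * (r2\<^sup>2 * (norm n2)\<^sup>2)"
      using convex_norm_sq_le[OF p, of "r1 *\<^sub>R n1" "r2 *\<^sub>R n2"] by (simp add: n_def power_mult_distrib)
    moreover have "(norm Y)\<^sup>2 \<le> p1 * (r1\<^sup>2 * (norm y)\<^sup>2) + p2 * (r2\<^sup>2 * (norm y)\<^sup>2)"
      using convex_norm_sq_le[OF p, of "r1 *\<^sub>R y" "r2 *\<^sub>R y"] unfolding Y_def by (simp add: power_mult_distrib)
    ultimately show "(norm (e *\<^sub>R d - u))\<^sup>2 + (norm Y)\<^sup>2 \<le> 2 * (e\<^sup>2 * (norm d)\<^sup>2) +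
        (2 * (p1 * (r1\<^sup>2 * (norm n1)\<^sup>2) + p2 * (r2\<^sup>2 * (norm n2)\<^sup>2)) +
         (p1 * (r1\<^sup>2 * (norm y)\<^sup>2) + p2 * (r2\<^sup>2 * (norm y)\<^sup>2)))"
      by (rule sum)
  qed (use \<eta> in simp)
  finally show ?thesis by (simp add: n_def Y_def)
qed

section \<open>Networks and time averages\<close>

lemma continuous_preact:
  "continuous_on UNIV (\<lambda>p. preact N W b (net_input (fst p :: real^'m) (snd p)) l r)"
proof (induction l arbitrary: r)
  case 0
  have "continuous_on UNIV (\<lambda>p. net_input (fst p :: real^'m) (snd p) c)" for c
    unfolding net_input_def by (cases "c < CARD('m)"; cases "c = CARD('m)") (auto intro!: continuous_intros)
  then show ?case
    by (auto simp: affine_layer_def intro!: continuous_intros)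
next
  case (Suc l)
  then show ?case
    by (auto simp: affine_layer_def intro!: continuous_intros)
qed

text \<open>A ReLU network is jointly continuous in \<open>z\<close> and \<open>t\<close>; the
  resulting measurability allows the approximation error to be split off as a separate
  integral.\<close>

lemma borel_measurable_relu_class:
  fixes f :: "real^'m \<Rightarrow> real \<Rightarrow> real^'m"
  assumes "f \<in> relu_class T L M J K \<kappa> \<gamma> \<gamma>t"
  shows "(\<lambda>p. f (fst p) (snd p)) \<in> borel_measurable borel"
proof -
  obtain n W b where f: "f = relu_net L n W b"
    using assms(1) by (auto simp: relu_class_def)
  have "continuous_on UNIV (\<lambda>p. f (fst p) (snd p))"
    unfolding f relu_net_def by (intro continuous_on_vec_lambda continuous_preact)
  then show ?thesis
    by (rule borel_measurable_continuous_onI)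
qed

lemma nn_time_avg_mono:
  "(\<And>t. t \<in> {t0..T} \<Longrightarrow> f t \<le> g t) \<Longrightarrow> nn_time_avg t0 T f \<le> nn_time_avg t0 T g"
  unfolding nn_time_avg_def
  by (intro mult_left_mono nn_integral_mono) (auto simp: indicator_def)

lemma nn_time_avg_cong:
  "(\<And>t. t \<in> {t0..T} \<Longrightarrow> f t = g t) \<Longrightarrow> nn_time_avg t0 T f = nn_time_avg t0 T g"
  by (intro antisym nn_time_avg_mono) auto

lemma nn_time_avg_add:
  assumes [measurable]: "f \<in> borel_measurable borel" "g \<in> borel_measurable borel"
  shows "nn_time_avg t0 T (\<lambda>t. f t + g t) = nn_time_avg t0 T f + nn_time_avg t0 T g"
  unfolding nn_time_avg_def
  by (simp add: distrib_right nn_integral_add distrib_left)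

lemma nn_time_avg_cmult:
  assumes [measurable]: "f \<in> borel_measurable borel"
  shows "nn_time_avg t0 T (\<lambda>t. c * f t) = c * nn_time_avg t0 T f"
  unfolding nn_time_avg_def
  by (simp add: nn_integral_cmult mult_ac)

lemma nn_time_avg_ennreal:
  assumes f: "continuous_on {t0..T} f" "\<And>t. t \<in> {t0..T} \<Longrightarrow> 0 \<le> f t" and "t0 < T"
  shows "nn_time_avg t0 T (\<lambda>t. ennreal (f t)) = ennreal (time_avg t0 T f)"
proof -
  have i: "integrable lborel (\<lambda>t. indicator {t0..T} t *\<^sub>R f t)"
    using borel_integrable_atLeastAtMost'[OF f(1)] by (simp add: set_integrable_def)
  have "(\<integral>\<^sup>+t\<in>{t0..T}. ennreal (f t) \<partial>lborel) = (\<integral>\<^sup>+t. ennreal (indicator {t0..T} t *\<^sub>R f t) \<partial>lborel)"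
    by (intro nn_integral_cong) (auto simp: indicator_def)
  also have "\<dots> = ennreal (LINT t:{t0..T}|lborel. f t)"
    unfolding set_lebesgue_integral_def
    by (rule nn_integral_eq_integral[OF i]) (auto simp: indicator_def f)
  finally show ?thesis
    using assms(3) unfolding nn_time_avg_def time_avg_def by (subst ennreal_mult') simp_all
qed

lemma time_avg_add:
  assumes "continuous_on {t0..T} f" "continuous_on {t0..T} g"
  shows "time_avg t0 T (\<lambda>t. f t + g t) = time_avg t0 T f + time_avg t0 T g"
  unfolding time_avg_def
  by (simp add: set_integral_add borel_integrable_atLeastAtMost'[OF assms(1)]
      borel_integrable_atLeastAtMost'[OF assms(2)] distrib_left add_divide_distrib)

lemma time_avg_cmult: "time_avg t0 T (\<lambda>t. c * f t) = c * time_avg t0 T f"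
  unfolding time_avg_def by simp

text \<open>For finite \<open>c\<close>, subtracting \<open>c\<close> and dividing by
  \<open>d\<close> gives a lower bound of all \<open>A f\<close>, hence of the infimum, also when
  \<open>F\<close> is empty and the infimum is infinite. For infinite \<open>c\<close> the right
  side is infinite.\<close>

lemma ennreal_INF_affine:
  fixes A :: "'a \<Rightarrow> ennreal"
  assumes "0 < d" "\<And>f. f \<in> F \<Longrightarrow> b \<le> c + ennreal d * A f"
  shows "b \<le> c + ennreal d * (INF f\<in>F. A f)"
proof (cases "c = top")
  case False
  have "(b - c) / ennreal d \<le> A f" if "f \<in> F" for f
  proof -
    have "b - c \<le> ennreal d * A f"
      using assms(2)[OF that] False by (simp add: ennreal_minus_le_iff)
    then show ?thesis
      using assms(1) by (intro divide_le_posI_ennreal) (auto simp: mult.commute)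
  qed
  then have "(b - c) / ennreal d \<le> (INF f\<in>F. A f)"
    by (rule INF_greatest)
  then have "ennreal d * ((b - c) / ennreal d) \<le> ennreal d * (INF f\<in>F. A f)"
    by (rule mult_left_mono) simp
  moreover have "ennreal d * ((b - c) / ennreal d) = b - c"
    using assms(1) by (subst ennreal_times_divide, subst mult.commute, intro ennreal_mult_divide_eq) auto
  ultimately show ?thesis
    using False by (simp add: ennreal_minus_le_iff)
qed simp

section \<open>The mixture\<close>

lemma (in latent_model) borel_measurable_ld_density [measurable]:
  "(\<lambda>p. ld_density C (f p) (g p)) \<in> borel_measurable N"
  if [measurable]: "f \<in> borel_measurable N" "g \<in> borel_measurable N"
  unfolding ld_density_eq by measurable

text \<open>
  \<open>nn_integral\<close> is additive only on measurable functions, whereas \<open>proj_density\<close> picks a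
  Radon--Nikodym derivative separately at each time and \<open>ld_score\<close> is a definite description. The
  explicit versions below are jointly measurable in time and space, and for each \<open>t > 0\<close> they agree
  with the originals up to null sets.
\<close>

definition gfun_formula :: "('d::finite, 'n::finite) component \<Rightarrow> real \<Rightarrow> real^'d \<Rightarrow> real^'d" where
  "gfun_formula C t y = hvar t *\<^sub>R ((1 / ld_density C t y) *\<^sub>R ld_gradient C t y) + y"

definition psi_formula :: "('d::finite, 'n::finite) component \<Rightarrow> real^'k^'n \<Rightarrow> real \<Rightarrow> real^'k \<Rightarrow> real^'k" where
  "psi_formula C W t z = (transpose W ** loading C) *v gfun_formula C t (transpose (loading C) *v (W *v z))"

text \<open>The share of data noise in the variance \<open>htilde C t\<close>, equal to
  \<open>1 - hvar t / htilde C t\<close>.\<close>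

definition noise_ratio :: "('d::finite, 'n::finite) component \<Rightarrow> real \<Rightarrow> real" where
  "noise_ratio C t = (alpha t)\<^sup>2 * (noise_sd C)\<^sup>2 / htilde C t"

locale latent_model_in_span = latent_model C
  for C :: "('d::finite, 'n::finite) component" +
  fixes W :: "real^'k^'n"
  assumes W: "orthonormal_cols W"
    and W_loading: "\<And>z. W *v (transpose W *v (loading C *v z)) = loading C *v z"
begin

lemma loading_W: "transpose (loading C) *v (W *v (transpose W *v x)) = transpose (loading C) *v x"
proof (rule vector_eq_rdot[THEN iffD1], rule allI)
  fix z
  show "(transpose (loading C) *v (W *v (transpose W *v x))) \<bullet> z = (transpose (loading C) *v x) \<bullet> z"
    by (metis W_loading inner_transpose_mult inner_commute)
qed

text \<open>The projection by \<open>W\<close> fixes the columns of the loading, so no length is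
  lost. This is what makes \<open>pinv\<close> in \<open>psi\<close> a transpose.\<close>

lemma orthonormal_W_loading: "orthonormal_cols (transpose W ** loading C)"
  unfolding orthonormal_cols_def matrix_eq
  by (simp add: matrix_transpose_mul matrix_vector_mul_assoc[symmetric] W_loading
      transpose_mult_orthonormal[OF loading])

lemma gfun_eq: "0 < t \<Longrightarrow> gfun C y t = gfun_formula C t y"
  by (simp add: gfun_def gfun_formula_def ld_score_eq)

lemma psi_eq: "0 < t \<Longrightarrow> psi C W z t = psi_formula C W t z"
  by (simp add: psi_def psi_formula_def Let_def pinv_orthonormal[OF orthonormal_W_loading] gfun_eq
      matrix_transpose_mul matrix_vector_mul_assoc)

lemma borel_measurable_psi_formula [measurable]:
  "(\<lambda>p. psi_formula C W (f p) (g p)) \<in> borel_measurable N"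
  if [measurable]: "f \<in> borel_measurable N" "g \<in> borel_measurable N"
  unfolding psi_formula_def gfun_formula_def by measurable

text \<open>Split \<open>x\<close> into its projection onto the loading and the residual. The
  projection completes the scaled latent score to g; the residual, reduced by
  \<open>hvar t / htilde C t\<close> of itself, keeps the factor
  \<open>noise_ratio C t\<close>.\<close>

lemma scaled_score_eq:
  assumes t: "0 < t"
  shows "hvar t *\<^sub>R (loading C *v ld_score C t (transpose (loading C) *v x) -
      (1 / htilde C t) *\<^sub>R (x - loading C *v (transpose (loading C) *v x))) + x =
    W *v psi_formula C W t (transpose W *v x) +
    noise_ratio C t *\<^sub>R (x - loading C *v (transpose (loading C) *v x))"
proof -
  define P where "P = x - loading C *v (transpose (loading C) *v x)"
  have r: "noise_ratio C t = 1 - hvar t / htilde C t"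
    using htilde_pos[OF t, of C] by (simp add: noise_ratio_def field_simps) (simp add: htilde_def)
  have "W *v psi_formula C W t (transpose W *v x) = loading C *v gfun_formula C t (transpose (loading C) *v x)"
    by (simp add: psi_formula_def matrix_vector_mul_assoc[symmetric] W_loading loading_W)
  also have "\<dots> = hvar t *\<^sub>R (loading C *v ld_score C t (transpose (loading C) *v x)) + (x - P)"
    by (simp add: gfun_formula_def ld_score_eq[OF t] matrix_vector_right_distrib matrix_vector_mult_scaleR P_def)
  finally show ?thesis
    unfolding P_def[symmetric] r by (simp add: algebra_simps)
qed

end

locale latent_mixture =
  c1: latent_model_in_span C1 W + c2: latent_model_in_span C2 W
  for C1 :: "('d1::finite, 'n::finite) component" and C2 :: "('d2::finite, 'n) component"
    and W :: "real^'k^'n" +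
  fixes w1 w2 :: real
  assumes w1: "0 < w1" and w2: "0 < w2"
begin

definition mx :: "real \<Rightarrow> real^'n \<Rightarrow> real" where
  "mx t x = w1 * smoothed C1 (loading C1) t x + w2 * smoothed C2 (loading C2) t x"

definition post :: "real \<Rightarrow> real^'n \<Rightarrow> real" where
  "post t x = w1 * smoothed C1 (loading C1) t x / mx t x"

definition qpost :: "real \<Rightarrow> real^'k \<Rightarrow> real" where
  "qpost t z = w1 * smoothed C1 (transpose W ** loading C1) t z /
    (w1 * smoothed C1 (transpose W ** loading C1) t z + w2 * smoothed C2 (transpose W ** loading C2) t z)"

definition target :: "real \<Rightarrow> real^'k \<Rightarrow> real^'k" where
  "target t z = qpost t z *\<^sub>R psi_formula C1 W t z + (1 - qpost t z) *\<^sub>R psi_formula C2 W t z"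

definition approx_err :: "(real^'k \<Rightarrow> real \<Rightarrow> real^'k) \<Rightarrow> real \<Rightarrow> ennreal" where
  "approx_err f t = (\<integral>\<^sup>+x. ennreal (mx t x) *
     ennreal ((norm (f (transpose W *v x) t - target t (transpose W *v x)))\<^sup>2) \<partial>lborel)"

definition post_err :: "real \<Rightarrow> ennreal" where
  "post_err t = (\<integral>\<^sup>+x. ennreal (mx t x) *
     ennreal ((qpost t (transpose W *v x) - post t x)\<^sup>2 *
       (norm (psi_formula C1 W t (transpose W *v x) - psi_formula C2 W t (transpose W *v x)))\<^sup>2) \<partial>lborel)"

lemma borel_measurable_mx [measurable]:
  "(\<lambda>p. mx (f p) (g p)) \<in> borel_measurable N"
  if [measurable]: "f \<in> borel_measurable N" "g \<in> borel_measurable N"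
  unfolding mx_def by measurable

lemma borel_measurable_post [measurable]:
  "(\<lambda>p. post (f p) (g p)) \<in> borel_measurable N"
  if [measurable]: "f \<in> borel_measurable N" "g \<in> borel_measurable N"
  unfolding post_def by measurable

lemma borel_measurable_qpost [measurable]:
  "(\<lambda>p. qpost (f p) (g p)) \<in> borel_measurable N"
  if [measurable]: "f \<in> borel_measurable N" "g \<in> borel_measurable N"
  unfolding qpost_def by measurable

lemma borel_measurable_target [measurable]:
  "(\<lambda>p. target (f p) (g p)) \<in> borel_measurable N"
  if [measurable]: "f \<in> borel_measurable N" "g \<in> borel_measurable N"
  unfolding target_def by measurable

lemma borel_measurable_post_err [measurable]: "post_err \<in> borel_measurable borel"
  unfolding post_err_def by measurable

lemma borel_measurable_approx_err:
  assumes [measurable]: "(\<lambda>p. f (fst p) (snd p)) \<in> borel_measurable borel"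
  shows "approx_err f \<in> borel_measurable borel"
proof -
  have [measurable]: "(\<lambda>p. f (g p) (h p)) \<in> borel_measurable N"
    if "g \<in> borel_measurable N" "h \<in> borel_measurable N" for g h and N :: "'z measure"
    using measurable_compose[OF borel_measurable_Pair[OF that] assms] by simp
  show ?thesis unfolding approx_err_def by measurable
qed

lemma mx_pos: "0 < t \<Longrightarrow> 0 < mx t x"
  by (simp add: mx_def c1.smoothed_pos c2.smoothed_pos w1 w2 add_pos_pos)

lemma mix_density_eq: "0 < t \<Longrightarrow> mix_density w1 w2 C1 C2 t = mx t"
  by (simp add: fun_eq_iff mix_density_def mx_def c1.fwd_density_eq c2.fwd_density_eq)

lemma mix_law_eq: "0 < t \<Longrightarrow> mix_law w1 w2 C1 C2 t = density lborel (\<lambda>x. ennreal (mx t x))"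
  by (simp add: mix_law_def mix_density_eq)

lemma post1_eq: "0 < t \<Longrightarrow> post1 w1 w2 C1 C2 x t = post t x"
  by (simp add: post1_def post_def mix_density_eq c1.fwd_density_eq)

text \<open>The exceptional null set lies in the projected space and is pulled back by
  \<open>AE_lborel_transpose_mult\<close>. Positive denominators make the two posteriors
  complementary.\<close>

lemma AE_proj_post:
  assumes t: "0 < t"
  shows "AE x in lborel. proj_post1 w1 w2 C1 C2 W (transpose W *v x) t = qpost t (transpose W *v x) \<and>
    proj_post2 w1 w2 C1 C2 W (transpose W *v x) t = 1 - qpost t (transpose W *v x)"
proof (rule AE_lborel_transpose_mult[OF c1.W])
  show "AE z in lborel. proj_post1 w1 w2 C1 C2 W z t = qpost t z \<and> proj_post2 w1 w2 C1 C2 W z t = 1 - qpost t z"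
    using c1.AE_proj_density[OF c1.W t] c2.AE_proj_density[OF c1.W t]
  proof eventually_elim
    case (elim z)
    have "0 < w1 * smoothed C1 (transpose W ** loading C1) t z + w2 * smoothed C2 (transpose W ** loading C2) t z"
      by (simp add: c1.smoothed_pos c2.smoothed_pos w1 w2 t add_pos_pos)
    then show ?case
      by (simp add: proj_post1_def proj_post2_def qpost_def elim field_simps)
  qed
qed

lemma AE_f_comp:
  assumes t: "0 < t"
  shows "AE x in lborel. f_comp w1 w2 C1 C2 W (transpose W *v x) t = target t (transpose W *v x)"
  using AE_proj_post[OF t]
  by eventually_elim (simp add: f_comp_def target_def c1.psi_eq c2.psi_eq t)

lemma AE_mix_law: "0 < t \<Longrightarrow> AE x in lborel. Q x \<Longrightarrow> AE x in mix_law w1 w2 C1 C2 t. Q x"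
  unfolding mix_law_eq by (subst AE_density) (auto elim: eventually_mono)

lemma nn_integral_mix_law:
  "0 < t \<Longrightarrow> F \<in> borel_measurable borel \<Longrightarrow>
    (\<integral>\<^sup>+x. F x \<partial>mix_law w1 w2 C1 C2 t) = (\<integral>\<^sup>+x. ennreal (mx t x) * F x \<partial>lborel)"
  unfolding mix_law_eq by (subst nn_integral_density) simp_all

lemma approx_err_eq:
  assumes t: "0 < t" and f: "(\<lambda>p. f (fst p) (snd p)) \<in> borel_measurable borel"
  shows "(\<integral>\<^sup>+x. ennreal ((norm (f (transpose W *v x) t - f_comp w1 w2 C1 C2 W (transpose W *v x) t))\<^sup>2)
      \<partial>mix_law w1 w2 C1 C2 t) = approx_err f t"
proof -
  have [measurable]: "(\<lambda>z. f z t) \<in> borel_measurable borel"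
    using measurable_compose[OF borel_measurable_Pair[of "\<lambda>z. z" borel "\<lambda>_. t"] f] by simp
  have "(\<integral>\<^sup>+x. ennreal ((norm (f (transpose W *v x) t - f_comp w1 w2 C1 C2 W (transpose W *v x) t))\<^sup>2)
      \<partial>mix_law w1 w2 C1 C2 t) =
    (\<integral>\<^sup>+x. ennreal ((norm (f (transpose W *v x) t - target t (transpose W *v x)))\<^sup>2) \<partial>mix_law w1 w2 C1 C2 t)"
    by (intro nn_integral_cong_AE AE_mix_law[OF t] eventually_mono[OF AE_f_comp[OF t]]) simp
  also have "\<dots> = approx_err f t"
    unfolding approx_err_def by (rule nn_integral_mix_law[OF t]) measurable
  finally show ?thesis .
qed

lemma post_err_eq:
  assumes t: "0 < t"
  shows "(\<integral>\<^sup>+x. ennreal ((proj_post1 w1 w2 C1 C2 W (transpose W *v x) t - post1 w1 w2 C1 C2 x t)\<^sup>2 *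
      (norm (psi C1 W (transpose W *v x) t - psi C2 W (transpose W *v x) t))\<^sup>2) \<partial>mix_law w1 w2 C1 C2 t) = post_err t"
proof -
  have "(\<integral>\<^sup>+x. ennreal ((proj_post1 w1 w2 C1 C2 W (transpose W *v x) t - post1 w1 w2 C1 C2 x t)\<^sup>2 *
      (norm (psi C1 W (transpose W *v x) t - psi C2 W (transpose W *v x) t))\<^sup>2) \<partial>mix_law w1 w2 C1 C2 t) =
    (\<integral>\<^sup>+x. ennreal ((qpost t (transpose W *v x) - post t x)\<^sup>2 *
      (norm (psi_formula C1 W t (transpose W *v x) - psi_formula C2 W t (transpose W *v x)))\<^sup>2) \<partial>mix_law w1 w2 C1 C2 t)"
    by (intro nn_integral_cong_AE AE_mix_law[OF t] eventually_mono[OF AE_proj_post[OF t]])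
      (simp add: post1_eq c1.psi_eq c2.psi_eq t)
  also have "\<dots> = post_err t"
    unfolding post_err_def by (rule nn_integral_mix_law[OF t]) measurable
  finally show ?thesis .
qed

text \<open>The logarithmic derivative of a sum weights each component's score by that component's
  share of the density, which is its posterior.\<close>

lemma grad_ln_mix_density:
  assumes t: "0 < t"
  shows "grad (\<lambda>y. ln (mix_density w1 w2 C1 C2 t y)) x =
    post t x *\<^sub>R (loading C1 *v ld_score C1 t (transpose (loading C1) *v x) -
      (1 / htilde C1 t) *\<^sub>R (x - loading C1 *v (transpose (loading C1) *v x))) +
    (1 - post t x) *\<^sub>R (loading C2 *v ld_score C2 t (transpose (loading C2) *v x) -
      (1 / htilde C2 t) *\<^sub>R (x - loading C2 *v (transpose (loading C2) *v x)))"
    (is "_ = _ *\<^sub>R ?s1 + _ *\<^sub>R ?s2")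
proof (rule grad_eqI)
  have d1: "GDERIV (\<lambda>x. w1 * smoothed C1 (loading C1) t x) x :> w1 *\<^sub>R (smoothed C1 (loading C1) t x *\<^sub>R ?s1)"
    by (rule GDERIV_DERIV_compose[OF c1.GDERIV_smoothed[OF c1.loading t]]) (auto intro!: derivative_eq_intros)
  have d2: "GDERIV (\<lambda>x. w2 * smoothed C2 (loading C2) t x) x :> w2 *\<^sub>R (smoothed C2 (loading C2) t x *\<^sub>R ?s2)"
    by (rule GDERIV_DERIV_compose[OF c2.GDERIV_smoothed[OF c2.loading t]]) (auto intro!: derivative_eq_intros)
  have "GDERIV (mx t) x :> w1 *\<^sub>R (smoothed C1 (loading C1) t x *\<^sub>R ?s1) + w2 *\<^sub>R (smoothed C2 (loading C2) t x *\<^sub>R ?s2)"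
    using GDERIV_add[OF d1 d2] by (simp add: mx_def[abs_def])
  then have "GDERIV (\<lambda>y. ln (mx t y)) x :> (1 / mx t x) *\<^sub>R
     (w1 *\<^sub>R (smoothed C1 (loading C1) t x *\<^sub>R ?s1) + w2 *\<^sub>R (smoothed C2 (loading C2) t x *\<^sub>R ?s2))"
    by (rule GDERIV_DERIV_compose) (use mx_pos[OF t, of x] in \<open>auto intro!: derivative_eq_intros\<close>)
  also have "(1 / mx t x) *\<^sub>R (w1 *\<^sub>R (smoothed C1 (loading C1) t x *\<^sub>R ?s1) + w2 *\<^sub>R (smoothed C2 (loading C2) t x *\<^sub>R ?s2)) =
     post t x *\<^sub>R ?s1 + (w2 * smoothed C2 (loading C2) t x / mx t x) *\<^sub>R ?s2"
    by (simp add: post_def scaleR_add_right)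
  also have "w2 * smoothed C2 (loading C2) t x / mx t x = 1 - post t x"
    using mx_pos[OF t, of x] by (simp add: post_def field_simps) (simp add: mx_def)
  finally show "GDERIV (\<lambda>y. ln (mix_density w1 w2 C1 C2 t y)) x :> post t x *\<^sub>R ?s1 + (1 - post t x) *\<^sub>R ?s2"
    by (simp add: mix_density_eq[OF t])
qed

lemma pointwise_error_bound:
  fixes x :: "real^'n" and u :: "real^'k"
  assumes t: "0 < t" and \<eta>: "0 < \<eta>"
  defines "n1 \<equiv> W *v (transpose W *v x) - loading C1 *v (transpose (loading C1) *v x)"
    and "n2 \<equiv> W *v (transpose W *v x) - loading C2 *v (transpose (loading C2) *v x)"
    and "y \<equiv> x - W *v (transpose W *v x)"
    and "z \<equiv> transpose W *v x"
  shows "(norm ((1 / hvar t) *\<^sub>R (W *v u) - (1 / hvar t) *\<^sub>R x -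
        grad (\<lambda>y. ln (mix_density w1 w2 C1 C2 t y)) x))\<^sup>2
    \<le> (1 / (hvar t)\<^sup>2) * ((1 + 1 / \<eta>) * (norm (u - target t z))\<^sup>2 +
       (1 + \<eta>) * (2 * ((qpost t z - post t x)\<^sup>2 * (norm (psi_formula C1 W t z - psi_formula C2 W t z))\<^sup>2) +
        (2 * (post t x * ((noise_ratio C1 t)\<^sup>2 * (norm n1)\<^sup>2) + (1 - post t x) * ((noise_ratio C2 t)\<^sup>2 * (norm n2)\<^sup>2)) +
         (post t x * ((noise_ratio C1 t)\<^sup>2 * (norm y)\<^sup>2) + (1 - post t x) * ((noise_ratio C2 t)\<^sup>2 * (norm y)\<^sup>2)))))"
proof -
  define h where "h = hvar t"
  have h: "0 < h" unfolding h_def by (rule hvar_pos[OF t])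
  define p where "p = post t x"
  define s1 where "s1 = loading C1 *v ld_score C1 t (transpose (loading C1) *v x) -
      (1 / htilde C1 t) *\<^sub>R (x - loading C1 *v (transpose (loading C1) *v x))"
  define s2 where "s2 = loading C2 *v ld_score C2 t (transpose (loading C2) *v x) -
      (1 / htilde C2 t) *\<^sub>R (x - loading C2 *v (transpose (loading C2) *v x))"
  define f1 where "f1 = psi_formula C1 W t z"
  define f2 where "f2 = psi_formula C2 W t z"
  define r1 where "r1 = noise_ratio C1 t"
  define r2 where "r2 = noise_ratio C2 t"
  define q where "q = qpost t z"
  define E where "E = W *v ((u - target t z) + (q - p) *\<^sub>R (f1 - f2)) -
      (p *\<^sub>R (r1 *\<^sub>R n1) + (1 - p) *\<^sub>R (r2 *\<^sub>R n2)) - (p *\<^sub>R (r1 *\<^sub>R y) + (1 - p) *\<^sub>R (r2 *\<^sub>R y))"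
  have hs1: "h *\<^sub>R s1 + x = W *v f1 + r1 *\<^sub>R (n1 + y)"
    using c1.scaled_score_eq[OF t, of x]
    by (simp add: h_def s1_def f1_def r1_def n1_def y_def z_def)
  have hs2: "h *\<^sub>R s2 + x = W *v f2 + r2 *\<^sub>R (n2 + y)"
    using c2.scaled_score_eq[OF t, of x]
    by (simp add: h_def s2_def f2_def r2_def n2_def y_def z_def)
  have p01: "0 \<le> p" "0 \<le> 1 - p" "p + (1 - p) = 1"
    using mx_pos[OF t, of x] less_imp_le[OF c1.smoothed_pos[OF t, of "loading C1" x]]
      less_imp_le[OF c2.smoothed_pos[OF t, of "loading C2" x]] w1 w2
    by (simp_all add: p_def post_def) (simp add: mx_def)
  \<comment> \<open>The posteriors sum to 1, so \<open>x\<close> can be distributed over the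
    components and the scaled score identity used in each.\<close>
  have "h *\<^sub>R (p *\<^sub>R s1 + (1 - p) *\<^sub>R s2) + x = p *\<^sub>R (h *\<^sub>R s1 + x) + (1 - p) *\<^sub>R (h *\<^sub>R s2 + x)"
    by (simp add: algebra_simps)
  also have "\<dots> = p *\<^sub>R (W *v f1 + r1 *\<^sub>R (n1 + y)) + (1 - p) *\<^sub>R (W *v f2 + r2 *\<^sub>R (n2 + y))"
    by (simp only: hs1 hs2)
  finally have "W *v u - x - h *\<^sub>R (p *\<^sub>R s1 + (1 - p) *\<^sub>R s2) = 
     W *v u - (p *\<^sub>R (W *v f1 + r1 *\<^sub>R (n1 + y)) + (1 - p) *\<^sub>R (W *v f2 + r2 *\<^sub>R (n2 + y)))"
    by (simp add: algebra_simps)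
  also have "\<dots> = E"
  proof -
    \<comment> \<open>Two averages of the same pair \<open>f1\<close>, \<open>f2\<close> with
      weights \<open>q\<close> and \<open>p\<close> differ by
      \<open>(q - p) *\<^sub>R (f1 - f2)\<close>; a single posterior gap therefore suffices.\<close>
    have "(u - target t z) + (q - p) *\<^sub>R (f1 - f2) = u - (p *\<^sub>R f1 + (1 - p) *\<^sub>R f2)"
      by (simp add: target_def q_def[symmetric] f1_def[symmetric] f2_def[symmetric] algebra_simps)
    then have "E = W *v u - (p *\<^sub>R (W *v f1) + (1 - p) *\<^sub>R (W *v f2)) -
      (p *\<^sub>R (r1 *\<^sub>R n1) + (1 - p) *\<^sub>R (r2 *\<^sub>R n2)) - (p *\<^sub>R (r1 *\<^sub>R y) + (1 - p) *\<^sub>R (r2 *\<^sub>R y))"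
      by (simp only: E_def matrix_vector_mult_diff_distrib matrix_vector_right_distrib matrix_vector_mult_scaleR)
    then show ?thesis by (simp add: scaleR_add_right)
  qed
  finally have E: "W *v u - x - h *\<^sub>R (p *\<^sub>R s1 + (1 - p) *\<^sub>R s2) = E" .
  have "(1 / h) *\<^sub>R (W *v u) - (1 / h) *\<^sub>R x - grad (\<lambda>y. ln (mix_density w1 w2 C1 C2 t y)) x = (1 / h) *\<^sub>R E"
    unfolding grad_ln_mix_density[OF t] p_def[symmetric] s1_def[symmetric] s2_def[symmetric]
    using h by (simp add: E[symmetric] scaleR_diff_right)
  then have "(norm ((1 / h) *\<^sub>R (W *v u) - (1 / h) *\<^sub>R x - grad (\<lambda>y. ln (mix_density w1 w2 C1 C2 t y)) x))\<^sup>2 =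
     (1 / h\<^sup>2) * (norm E)\<^sup>2"
    by (simp add: power_divide)
  also have "\<dots> \<le> (1 / h\<^sup>2) * ((1 + 1 / \<eta>) * (norm (u - target t z))\<^sup>2 + (1 + \<eta>) * (2 * ((q - p)\<^sup>2 * (norm (f1 - f2))\<^sup>2) +
        (2 * (p * (r1\<^sup>2 * (norm n1)\<^sup>2) + (1 - p) * (r2\<^sup>2 * (norm n2)\<^sup>2)) +
         (p * (r1\<^sup>2 * (norm y)\<^sup>2) + (1 - p) * (r2\<^sup>2 * (norm y)\<^sup>2)))))"
    unfolding E_def
  proof (intro mult_left_mono score_error_bound[OF c1.W \<eta> p01])
    show "W *v (transpose W *v n1) = n1" "W *v (transpose W *v n2) = n2" "transpose W *v y = 0"
      by (simp_all add: n1_def n2_def y_def matrix_vector_mult_diff_distrib transpose_mult_orthonormal[OF c1.W]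
          c1.W_loading c2.W_loading)
  qed simp
  finally show ?thesis
    by (simp only: h_def p_def q_def f1_def f2_def r1_def r2_def)
qed

end

section \<open>Integration of the pointwise bound over space and time\<close>

definition noise_rate :: "('d::finite, 'n::finite) component \<Rightarrow> real \<Rightarrow> real" where
  "noise_rate C t = (alpha t)^4 * (noise_sd C)^4 / ((hvar t)\<^sup>2 * htilde C t)"

lemma noise_rate_nonneg: "0 < t \<Longrightarrow> 0 \<le> noise_rate C t"
  using htilde_pos[of t C] by (simp add: noise_rate_def)

text \<open>Squared coefficient of the noise in the score error, times its variance per
  dimension.\<close>

lemma noise_rate_eq:
  "0 < t \<Longrightarrow> noise_rate C t = (noise_ratio C t)\<^sup>2 / (hvar t)\<^sup>2 * htilde C t"
  using htilde_pos[of t C] hvar_pos[of t]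
  by (simp add: noise_rate_def noise_ratio_def power_mult_distrib power_divide field_simps
      flip: power_mult) (simp add: power2_eq_square power4_eq_xxxx)

lemma continuous_on_noise_rate:
  assumes "0 < t0"
  shows "continuous_on {t0..T} (noise_rate C)"
proof -
  have "hvar t \<noteq> 0" "htilde C t \<noteq> 0" if "t \<in> {t0..T}" for t
    using that assms hvar_pos[of t] htilde_pos[of t C] by auto
  then show ?thesis
    unfolding noise_rate_def alpha_def hvar_def htilde_def
    by (auto intro!: continuous_intros)
qed

lemma time_avg_noise_rate: "time_avg t0 T (noise_rate C) = nbar t0 T C"
  by (simp add: nbar_def noise_rate_def[abs_def])

context latent_mixture
begin

text \<open>The D - k orthogonal dimensions count once, and the k - d_i inner ones twice because
  they were separated from the posterior mismatch.\<close>

definition noise_floor :: "real \<Rightarrow> real" where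
  "noise_floor t =
    w1 * noise_rate C1 t * ((real CARD('n) - real CARD('k)) + 2 * (real CARD('k) - real CARD('d1))) +
    w2 * noise_rate C2 t * ((real CARD('n) - real CARD('k)) + 2 * (real CARD('k) - real CARD('d2)))"

lemma noise_floor_nonneg:
  assumes "0 < t" "CARD('d1) \<le> CARD('k)" "CARD('d2) \<le> CARD('k)" "CARD('k) \<le> CARD('n)"
  shows "0 \<le> noise_floor t"
  using assms w1 w2 noise_rate_nonneg[of t C1] noise_rate_nonneg[of t C2]
  by (simp add: noise_floor_def)

lemma inner_risk_bound:
  assumes t: "0 < t" and \<eta>: "0 < \<eta>" and f: "(\<lambda>p. f (fst p) (snd p)) \<in> borel_measurable borel"
    and dims: "CARD('d1) \<le> CARD('k)" "CARD('d2) \<le> CARD('k)" "CARD('k) \<le> CARD('n)"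
  shows "(\<integral>\<^sup>+x. ennreal ((norm ((1 / hvar t) *\<^sub>R (W *v f (transpose W *v x) t) - (1 / hvar t) *\<^sub>R x -
        grad (\<lambda>y. ln (mix_density w1 w2 C1 C2 t y)) x))\<^sup>2) \<partial>mix_law w1 w2 C1 C2 t)
    \<le> ennreal (1 + 1 / \<eta>) * (ennreal (1 / (hvar t)\<^sup>2) * approx_err f t) +
      ennreal (1 + \<eta>) * (2 * (ennreal (1 / (hvar t)\<^sup>2) * post_err t) + ennreal (noise_floor t))"
proof -
  have [measurable]: "(\<lambda>z. f z t) \<in> borel_measurable borel"
    using measurable_compose[OF borel_measurable_Pair[of "\<lambda>z. z" borel "\<lambda>_. t"] f] by simp
  define h where "h = hvar t"
  have h: "0 < h" unfolding h_def by (rule hvar_pos[OF t])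
  define k where "k = 1 / h\<^sup>2"
  have k: "0 \<le> k" by (simp add: k_def)
  define A where "A x = (norm (f (transpose W *v x) t - target t (transpose W *v x)))\<^sup>2" for x
  define P where "P x = (qpost t (transpose W *v x) - post t x)\<^sup>2 *
       (norm (psi_formula C1 W t (transpose W *v x) - psi_formula C2 W t (transpose W *v x)))\<^sup>2" for x
  define N1 where "N1 x = (norm (W *v (transpose W *v x) - loading C1 *v (transpose (loading C1) *v x)))\<^sup>2" for x
  define N2 where "N2 x = (norm (W *v (transpose W *v x) - loading C2 *v (transpose (loading C2) *v x)))\<^sup>2" for x
  define Y where "Y x = (norm (x - W *v (transpose W *v x)))\<^sup>2" for x
  define m1 where "m1 = smoothed C1 (loading C1) t"
  define m2 where "m2 = smoothed C2 (loading C2) t"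
  define r1 where "r1 = (noise_ratio C1 t)\<^sup>2"
  define r2 where "r2 = (noise_ratio C2 t)\<^sup>2"
  define c1 where "c1 = 1 + 1 / \<eta>"
  define c2 where "c2 = 1 + \<eta>"
  have c: "0 \<le> c1" "0 \<le> c2" using \<eta> by (auto simp: c1_def c2_def)
  have [measurable]: "A \<in> borel_measurable borel" "P \<in> borel_measurable borel" "N1 \<in> borel_measurable borel"
      "N2 \<in> borel_measurable borel" "Y \<in> borel_measurable borel" "m1 \<in> borel_measurable borel"
      "m2 \<in> borel_measurable borel"
    unfolding A_def P_def N1_def N2_def Y_def m1_def m2_def by measurable
  have nn: "0 \<le> A x" "0 \<le> P x" "0 \<le> N1 x" "0 \<le> N2 x" "0 \<le> Y x" "0 \<le> m1 x" "0 \<le> m2 x" "0 \<le> r1" "0 \<le> r2"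
      "0 \<le> mx t x" for x
    using less_imp_le[OF c1.smoothed_pos[OF t, of "loading C1" x]]
      less_imp_le[OF c2.smoothed_pos[OF t, of "loading C2" x]] less_imp_le[OF mx_pos[OF t, of x]]
    by (simp_all add: A_def P_def N1_def N2_def Y_def m1_def m2_def r1_def r2_def)
  \<comment> \<open>Turns posterior-weighted integrals under the mixture into integrals under one
    component, where the Gaussian moments are known.\<close>
  have mp: "mx t x * post t x = w1 * m1 x" "mx t x * (1 - post t x) = w2 * m2 x" for x
    using mx_pos[OF t, of x]
    by (simp_all add: post_def m1_def right_diff_distrib) (simp add: mx_def m2_def)
  let ?B = "\<lambda>x. k * (c1 * A x + c2 * (2 * P x +
        (2 * (post t x * (r1 * N1 x) + (1 - post t x) * (r2 * N2 x)) +
         (post t x * (r1 * Y x) + (1 - post t x) * (r2 * Y x)))))"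
  \<comment> \<open>Monotonicity holds without measurability, so the error containing
    \<open>grad\<close> is replaced by a measurable majorant before the integral is split.\<close>
  have "(\<integral>\<^sup>+x. ennreal ((norm ((1 / h) *\<^sub>R (W *v f (transpose W *v x) t) - (1 / h) *\<^sub>R x -
        grad (\<lambda>y. ln (mix_density w1 w2 C1 C2 t y)) x))\<^sup>2) \<partial>mix_law w1 w2 C1 C2 t)
     \<le> (\<integral>\<^sup>+x. ennreal (?B x) \<partial>mix_law w1 w2 C1 C2 t)"
    using pointwise_error_bound[OF t \<eta>]
    by (intro nn_integral_mono ennreal_leI) (simp only: h_def k_def A_def P_def N1_def N2_def Y_def r1_def r2_def c1_def c2_def)
  also have "\<dots> = (\<integral>\<^sup>+x. ennreal (mx t x) * ennreal (?B x) \<partial>lborel)"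
    by (rule nn_integral_mix_law[OF t]) measurable
  also have "\<dots> = (\<integral>\<^sup>+x. ennreal (k * c1) * (ennreal (mx t x) * ennreal (A x)) +
      (ennreal (k * c2 * 2) * (ennreal (mx t x) * ennreal (P x)) +
      (ennreal (k * c2 * 2 * r1 * w1) * (ennreal (N1 x) * ennreal (m1 x)) +
      (ennreal (k * c2 * 2 * r2 * w2) * (ennreal (N2 x) * ennreal (m2 x)) +
      (ennreal (k * c2 * r1 * w1) * (ennreal (Y x) * ennreal (m1 x)) +
       ennreal (k * c2 * r2 * w2) * (ennreal (Y x) * ennreal (m2 x)))))) \<partial>lborel)"
  proof (rule nn_integral_cong)
    fix x
    have "mx t x * ?B x = k * c1 * (mx t x * A x) + (k * c2 * 2 * (mx t x * P x) +
      (k * c2 * 2 * r1 * ((mx t x * post t x) * N1 x) + (k * c2 * 2 * r2 * ((mx t x * (1 - post t x)) * N2 x) +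
      (k * c2 * r1 * ((mx t x * post t x) * Y x) + k * c2 * r2 * ((mx t x * (1 - post t x)) * Y x)))))"
      by (simp add: algebra_simps)
    also have "\<dots> = k * c1 * (mx t x * A x) + (k * c2 * 2 * (mx t x * P x) +
      (k * c2 * 2 * r1 * w1 * (N1 x * m1 x) + (k * c2 * 2 * r2 * w2 * (N2 x * m2 x) +
      (k * c2 * r1 * w1 * (Y x * m1 x) + k * c2 * r2 * w2 * (Y x * m2 x)))))"
      unfolding mp by (simp add: mult_ac)
    finally have "ennreal (mx t x) * ennreal (?B x) = ennreal \<dots>"
      using nn by (simp add: ennreal_mult'[symmetric])
    then show "ennreal (mx t x) * ennreal (?B x) = ennreal (k * c1) * (ennreal (mx t x) * ennreal (A x)) +
      (ennreal (k * c2 * 2) * (ennreal (mx t x) * ennreal (P x)) +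
      (ennreal (k * c2 * 2 * r1 * w1) * (ennreal (N1 x) * ennreal (m1 x)) +
      (ennreal (k * c2 * 2 * r2 * w2) * (ennreal (N2 x) * ennreal (m2 x)) +
      (ennreal (k * c2 * r1 * w1) * (ennreal (Y x) * ennreal (m1 x)) +
       ennreal (k * c2 * r2 * w2) * (ennreal (Y x) * ennreal (m2 x))))))"
      using nn c k w1 w2 by (simp add: ennreal_mult[symmetric] ennreal_plus[symmetric] del: ennreal_plus)
  qed
  also have "\<dots> = ennreal (k * c1) * (\<integral>\<^sup>+x. ennreal (mx t x) * ennreal (A x) \<partial>lborel) +
      (ennreal (k * c2 * 2) * (\<integral>\<^sup>+x. ennreal (mx t x) * ennreal (P x) \<partial>lborel) +
      (ennreal (k * c2 * 2 * r1 * w1) * (\<integral>\<^sup>+x. ennreal (N1 x) * ennreal (m1 x) \<partial>lborel) +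
      (ennreal (k * c2 * 2 * r2 * w2) * (\<integral>\<^sup>+x. ennreal (N2 x) * ennreal (m2 x) \<partial>lborel) +
      (ennreal (k * c2 * r1 * w1) * (\<integral>\<^sup>+x. ennreal (Y x) * ennreal (m1 x) \<partial>lborel) +
       ennreal (k * c2 * r2 * w2) * (\<integral>\<^sup>+x. ennreal (Y x) * ennreal (m2 x) \<partial>lborel)))))"
    by (simp add: nn_integral_add nn_integral_cmult)
  also have "(\<integral>\<^sup>+x. ennreal (mx t x) * ennreal (A x) \<partial>lborel) = approx_err f t"
    by (simp add: approx_err_def A_def)
  also have "(\<integral>\<^sup>+x. ennreal (mx t x) * ennreal (P x) \<partial>lborel) = post_err t"
    by (simp add: post_err_def P_def)
  also have "(\<integral>\<^sup>+x. ennreal (N1 x) * ennreal (m1 x) \<partial>lborel) = ennreal (htilde C1 t * (real CARD('k) - real CARD('d1)))"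
    unfolding N1_def m1_def by (rule c1.nn_integral_fwd_nested_norm_sq[OF c1.W c1.W_loading t])
  also have "(\<integral>\<^sup>+x. ennreal (N2 x) * ennreal (m2 x) \<partial>lborel) = ennreal (htilde C2 t * (real CARD('k) - real CARD('d2)))"
    unfolding N2_def m2_def by (rule c2.nn_integral_fwd_nested_norm_sq[OF c1.W c2.W_loading t])
  also have "(\<integral>\<^sup>+x. ennreal (Y x) * ennreal (m1 x) \<partial>lborel) = ennreal (htilde C1 t * (real CARD('n) - real CARD('k)))"
    unfolding Y_def m1_def by (rule c1.nn_integral_fwd_perp_norm_sq[OF c1.W c1.W_loading t])
  also have "(\<integral>\<^sup>+x. ennreal (Y x) * ennreal (m2 x) \<partial>lborel) = ennreal (htilde C2 t * (real CARD('n) - real CARD('k)))"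
    unfolding Y_def m2_def by (rule c2.nn_integral_fwd_perp_norm_sq[OF c1.W c2.W_loading t])
  \<comment> \<open>The dimension bounds make each factor nonnegative, as additivity and
    multiplicativity of \<open>ennreal\<close> require.\<close>
  also have "ennreal (k * c2 * 2 * r1 * w1) * ennreal (htilde C1 t * (real CARD('k) - real CARD('d1))) +
      (ennreal (k * c2 * 2 * r2 * w2) * ennreal (htilde C2 t * (real CARD('k) - real CARD('d2))) +
      (ennreal (k * c2 * r1 * w1) * ennreal (htilde C1 t * (real CARD('n) - real CARD('k))) +
       ennreal (k * c2 * r2 * w2) * ennreal (htilde C2 t * (real CARD('n) - real CARD('k))))) =
     ennreal (k * c2 * 2 * r1 * w1 * (htilde C1 t * (real CARD('k) - real CARD('d1))) +
      (k * c2 * 2 * r2 * w2 * (htilde C2 t * (real CARD('k) - real CARD('d2))) +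
      (k * c2 * r1 * w1 * (htilde C1 t * (real CARD('n) - real CARD('k))) +
       k * c2 * r2 * w2 * (htilde C2 t * (real CARD('n) - real CARD('k))))))"
    using nn c k w1 w2 dims htilde_pos[OF t, of C1] htilde_pos[OF t, of C2]
    by (simp add: ennreal_mult[symmetric] ennreal_plus[symmetric] del: ennreal_plus)
  also have "k * c2 * 2 * r1 * w1 * (htilde C1 t * (real CARD('k) - real CARD('d1))) +
      (k * c2 * 2 * r2 * w2 * (htilde C2 t * (real CARD('k) - real CARD('d2))) +
      (k * c2 * r1 * w1 * (htilde C1 t * (real CARD('n) - real CARD('k))) +
       k * c2 * r2 * w2 * (htilde C2 t * (real CARD('n) - real CARD('k))))) = c2 * noise_floor t"
  proof -
    have "noise_rate C1 t = k * r1 * htilde C1 t" "noise_rate C2 t = k * r2 * htilde C2 t"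
      by (simp_all add: noise_rate_eq[OF t] k_def h_def r1_def r2_def)
    then show ?thesis by (simp add: noise_floor_def algebra_simps)
  qed
  also have "ennreal (c2 * noise_floor t) = ennreal c2 * ennreal (noise_floor t)"
    using c by (simp add: ennreal_mult')
  also have "ennreal (k * c1) = ennreal c1 * ennreal k"
    using c k by (simp add: ennreal_mult mult.commute)
  also have "ennreal (k * c2 * 2) = ennreal c2 * (2 * ennreal k)"
    using c k by (simp add: ennreal_mult mult_ac)
  finally show ?thesis
    by (simp add: h_def k_def c1_def c2_def distrib_left mult.assoc)
qed

lemma L_mix_bound:
  assumes t0: "0 < t0" "t0 < T" and \<eta>: "0 < \<eta>"
    and f: "(\<lambda>p. f (fst p) (snd p)) \<in> borel_measurable borel"
    and dims: "CARD('d1) \<le> CARD('k)" "CARD('d2) \<le> CARD('k)" "CARD('k) \<le> CARD('n)"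
  shows "L_mix t0 T w1 w2 C1 C2
      (\<lambda>x t. (1 / hvar t) *\<^sub>R (W *v f (transpose W *v x) t) - (1 / hvar t) *\<^sub>R x)
    \<le> ennreal (1 + \<eta>) *
        (ennreal ((w1 * nbar t0 T C1 + w2 * nbar t0 T C2) * (real CARD('n) - real CARD('k))
            + 2 * (w1 * nbar t0 T C1 * (real CARD('k) - real CARD('d1))
                 + w2 * nbar t0 T C2 * (real CARD('k) - real CARD('d2))))
          + 2 * P_mix t0 T w1 w2 C1 C2 W)
      + ennreal (1 + 1 / \<eta>) * A_mix t0 T w1 w2 C1 C2 f W"
proof -
  note [measurable] = borel_measurable_approx_err[OF f]
  have pos: "0 < t" if "t \<in> {t0..T}" for t using that t0 by simp
  have A: "A_mix t0 T w1 w2 C1 C2 f W = nn_time_avg t0 T (\<lambda>t. ennreal (1 / (hvar t)\<^sup>2) * approx_err f t)"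
    unfolding A_mix_def by (rule nn_time_avg_cong) (simp add: approx_err_eq[OF pos f])
  have P: "P_mix t0 T w1 w2 C1 C2 W = nn_time_avg t0 T (\<lambda>t. ennreal (1 / (hvar t)\<^sup>2) * post_err t)"
    unfolding P_mix_def by (rule nn_time_avg_cong) (simp add: post_err_eq[OF pos])
  have cont: "continuous_on {t0..T} (noise_rate C1)" "continuous_on {t0..T} (noise_rate C2)"
    using t0(1) by (rule continuous_on_noise_rate)+
  have [measurable]: "noise_floor \<in> borel_measurable borel"
    unfolding noise_floor_def noise_rate_def by measurable
  \<comment> \<open>On \<open>{t0..T}\<close> with \<open>0 < t0\<close> the noise rates are
    continuous, so this average is a finite real expressible through \<open>nbar\<close>.\<close>
  have floor: "nn_time_avg t0 T (\<lambda>t. ennreal (noise_floor t)) =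
     ennreal ((w1 * nbar t0 T C1 + w2 * nbar t0 T C2) * (real CARD('n) - real CARD('k))
            + 2 * (w1 * nbar t0 T C1 * (real CARD('k) - real CARD('d1))
                 + w2 * nbar t0 T C2 * (real CARD('k) - real CARD('d2))))"
  proof -
    have eq: "noise_floor = (\<lambda>t.
       (w1 * ((real CARD('n) - real CARD('k)) + 2 * (real CARD('k) - real CARD('d1)))) * noise_rate C1 t +
       (w2 * ((real CARD('n) - real CARD('k)) + 2 * (real CARD('k) - real CARD('d2)))) * noise_rate C2 t)"
      by (simp add: fun_eq_iff noise_floor_def mult_ac)
    have "continuous_on {t0..T} noise_floor"
      unfolding eq by (intro continuous_intros cont)
    then have "nn_time_avg t0 T (\<lambda>t. ennreal (noise_floor t)) = ennreal (time_avg t0 T noise_floor)"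
      using noise_floor_nonneg[OF pos dims] t0(2) by (rule nn_time_avg_ennreal)
    also have "time_avg t0 T noise_floor =
       (w1 * ((real CARD('n) - real CARD('k)) + 2 * (real CARD('k) - real CARD('d1)))) * nbar t0 T C1 +
       (w2 * ((real CARD('n) - real CARD('k)) + 2 * (real CARD('k) - real CARD('d2)))) * nbar t0 T C2"
      unfolding eq
      by (subst time_avg_add) (auto intro!: continuous_intros cont simp: time_avg_cmult time_avg_noise_rate)
    finally show ?thesis by (simp add: algebra_simps)
  qed
  have "L_mix t0 T w1 w2 C1 C2 (\<lambda>x t. (1 / hvar t) *\<^sub>R (W *v f (transpose W *v x) t) - (1 / hvar t) *\<^sub>R x)
    \<le> nn_time_avg t0 T (\<lambda>t. ennreal (1 + 1 / \<eta>) * (ennreal (1 / (hvar t)\<^sup>2) * approx_err f t) +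
      ennreal (1 + \<eta>) * (2 * (ennreal (1 / (hvar t)\<^sup>2) * post_err t) + ennreal (noise_floor t)))"
    unfolding L_mix_def
    by (intro nn_time_avg_mono inner_risk_bound[OF pos \<eta> f dims])
  also have "\<dots> = ennreal (1 + 1 / \<eta>) * A_mix t0 T w1 w2 C1 C2 f W +
      ennreal (1 + \<eta>) * (2 * P_mix t0 T w1 w2 C1 C2 W + nn_time_avg t0 T (\<lambda>t. ennreal (noise_floor t)))"
    unfolding A P by (simp add: nn_time_avg_add nn_time_avg_cmult)
  finally show ?thesis
    unfolding floor by (simp add: add_ac)
qed

end

lemma latent_model_in_spanI:
  fixes C :: "('d::finite, 'n::finite) component" and W :: "real^'k^'n"
  assumes "orthonormal_cols (loading C)" "0 < noise_sd C" and C: "regular_latent_density C"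
    and W: "orthonormal_cols W" and sub: "span (columns (loading C)) \<subseteq> span (columns W)"
  shows "latent_model_in_span C W"
proof (intro latent_model_in_span.intro latent_model.intro latent_model_in_span_axioms.intro)
  show "prob_space (latent_law C)" "0 \<le> latent_density C z" for z
    using C by (simp_all add: regular_latent_density_def latent_law_def less_imp_le)
  \<comment> \<open>Differentiability gives continuity of the latent density, hence the
    measurability that the locale asks for.\<close>
  obtain G where "\<And>z. GDERIV (latent_density C) z :> G z"
    using C unfolding regular_latent_density_def twice_continuously_differentiable_def by blast
  then have "isCont (latent_density C) z" for z
    unfolding gderiv_def by (rule has_derivative_continuous)
  then show "latent_density C \<in> borel_measurable borel"
    by (intro borel_measurable_continuous_onI continuous_at_imp_continuous_on ballI)
  show "W *v (transpose W *v (loading C *v z)) = loading C *v z" for z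
    using sub matrix_vector_mult_in_columnspace[of "loading C" z]
    by (intro proj_fixes_span_columns[OF W]) blast
qed (fact+)

theorem corollary8:
  fixes C1 :: "('d1::finite, 'n::finite) component"
    and C2 :: "('d2::finite, 'n) component"
    and W :: "real^'k^'n"
    and V1 :: "real^'d1^'n"
    and t0 T w1 w2 \<beta>1 \<beta>2 K \<kappa> \<gamma> \<gamma>t :: real
    and L M J :: nat
  assumes "0 < t0" and "t0 < T"
    and "orthonormal_cols (loading C1)" and "orthonormal_cols (loading C2)"
    and "noise_sd C1 > 0" and "noise_sd C2 > 0"
    and "uniformly_lipschitz_fstar T \<beta>1 C1" and "uniformly_lipschitz_fstar T \<beta>2 C2"
    and "regular_latent_density C1" and "regular_latent_density C2"
    and "time_regular_gfun t0 T C1" and "time_regular_gfun t0 T C2"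
    and "w1 > 0" and "w2 > 0" and "w1 + w2 = 1"
    and "max CARD('d1) CARD('d2) \<le> CARD('k)" and "CARD('k) \<le> CARD('n)"
    and "orthonormal_cols W"
    and "top_eigenspace CARD('k) (M_mix t0 T w1 w2 C1 C2) (span (columns W))"
    and "{u + v |u v. u \<in> span (columns (loading C1)) \<and> v \<in> span (columns (loading C2))}
           \<subseteq> span (columns W)"
  shows "(\<forall>\<eta>>0.
      B_mix t0 T w1 w2 C1 C2 (relu_class T L M J K \<kappa> \<gamma> \<gamma>t) W
        \<le> ennreal (1 + \<eta>) *
            (ennreal ((w1 * nbar t0 T C1 + w2 * nbar t0 T C2) * (real CARD('n) - real CARD('k))
                + 2 * (w1 * nbar t0 T C1 * (real CARD('k) - real CARD('d1))
                     + w2 * nbar t0 T C2 * (real CARD('k) - real CARD('d2))))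
              + 2 * P_mix t0 T w1 w2 C1 C2 W)
          + ennreal (1 + 1 / \<eta>) *
            (INF f\<in>relu_class T L M J K \<kappa> \<gamma> \<gamma>t. A_mix t0 T w1 w2 C1 C2 f W))
    \<and> (V1 = loading C1 \<longrightarrow>
        Gamma_obj t0 T w1 w2 C1 C2 V1
          = w2 * cbar t0 T C2 * (norm (perp_proj (loading C1) ** loading C2))\<^sup>2
        \<and> Gamma_obj t0 T w1 w2 C1 C2 W = 0)"
proof -
  \<comment> \<open>Each span lies in the sum: take 0 as the other summand.\<close>
  have sub: "span (columns (loading C1)) \<subseteq> span (columns W)" "span (columns (loading C2)) \<subseteq> span (columns W)"
    using assms(20) span_zero[of "columns (loading C1)"] span_zero[of "columns (loading C2)"]
    by (force intro: exI[of _ 0])+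
  interpret c1: latent_model_in_span C1 W
    by (rule latent_model_in_spanI) fact+
  interpret c2: latent_model_in_span C2 W
    by (rule latent_model_in_spanI) fact+
  interpret latent_mixture C1 C2 W w1 w2
    by unfold_locales fact+
  have dims: "CARD('d1) \<le> CARD('k)" "CARD('d2) \<le> CARD('k)" "CARD('k) \<le> CARD('n)"
    using assms(16,17) by auto
  let ?F = "relu_class T L M J K \<kappa> \<gamma> \<gamma>t :: (real^'k \<Rightarrow> real \<Rightarrow> real^'k) set"
  show ?thesis
  proof (intro conjI allI impI)
    fix \<eta> :: real assume \<eta>: "0 < \<eta>"
    show "B_mix t0 T w1 w2 C1 C2 ?F W
        \<le> ennreal (1 + \<eta>) *
            (ennreal ((w1 * nbar t0 T C1 + w2 * nbar t0 T C2) * (real CARD('n) - real CARD('k))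
                + 2 * (w1 * nbar t0 T C1 * (real CARD('k) - real CARD('d1))
                     + w2 * nbar t0 T C2 * (real CARD('k) - real CARD('d2))))
              + 2 * P_mix t0 T w1 w2 C1 C2 W)
          + ennreal (1 + 1 / \<eta>) * (INF f\<in>?F. A_mix t0 T w1 w2 C1 C2 f W)"
    proof (rule ennreal_INF_affine)
      show "0 < 1 + 1 / \<eta>" using \<eta> by (simp add: add_pos_pos)
      fix f assume f: "f \<in> ?F"
      have "(\<lambda>x t. (1 / hvar t) *\<^sub>R (W *v f (transpose W *v x) t) - (1 / hvar t) *\<^sub>R x) \<in> S_mix ?F W"
        using f by (auto simp: S_mix_def)
      then have "B_mix t0 T w1 w2 C1 C2 ?F W \<le> L_mix t0 T w1 w2 C1 C2
          (\<lambda>x t. (1 / hvar t) *\<^sub>R (W *v f (transpose W *v x) t) - (1 / hvar t) *\<^sub>R x)"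
        unfolding B_mix_def by (rule INF_lower)
      also note L_mix_bound[OF assms(1,2) \<eta> borel_measurable_relu_class[OF f] dims]
      finally show "B_mix t0 T w1 w2 C1 C2 ?F W
        \<le> ennreal (1 + \<eta>) *
            (ennreal ((w1 * nbar t0 T C1 + w2 * nbar t0 T C2) * (real CARD('n) - real CARD('k))
                + 2 * (w1 * nbar t0 T C1 * (real CARD('k) - real CARD('d1))
                     + w2 * nbar t0 T C2 * (real CARD('k) - real CARD('d2))))
              + 2 * P_mix t0 T w1 w2 C1 C2 W)
          + ennreal (1 + 1 / \<eta>) * A_mix t0 T w1 w2 C1 C2 f W" .
    qed
  next
    assume V1: "V1 = loading C1"
    have "perp_proj (loading C1) ** loading C1 = 0"
      by (rule perp_proj_mult_eq_0) (simp add: transpose_mult_orthonormal[OF assms(3)])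
    then show "Gamma_obj t0 T w1 w2 C1 C2 V1
        = w2 * cbar t0 T C2 * (norm (perp_proj (loading C1) ** loading C2))\<^sup>2"
      by (simp add: Gamma_obj_def V1)
    show "Gamma_obj t0 T w1 w2 C1 C2 W = 0"
      by (simp add: Gamma_obj_def perp_proj_mult_eq_0[OF c1.W_loading] perp_proj_mult_eq_0[OF c2.W_loading])
  qed
qed

end
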